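(* For every inner function $q$ on $\triangle_H$, the submodule $qH^2(\triangle_H)$ of $H^2(\triangle_H)$ is not doubly commuting.
   Context: The Hartogs triangle is $\triangle_H=\{(z,w)\in\mathbb{C}^2: |z|<|w|<1\}$. The Hardy space $H^2(\triangle_H)$ is the Hilbert space of holomorphic $f$ on $\triangle_H$ with $\|f\|^2=\sup_{s,t\in(0,1)}\frac{1}{4\pi^2}\int_0^{2\pi}\int_0^{2\pi}|f(ste^{i\theta},te^{i\gamma})|^2\,st^2\,d\theta\,d\gamma<\infty$; the functions $\frac1w(\frac zw)^iw^j$, $i,j\ge0$, form an orthonormal basis, and $H^2(\triangle_H)$ is identified via boundary values with a closed subspace of $L^2(\mathbb{T}^2)$ ($\mathbb{T}^2$ is the distinguished boundary of $\triangle_H$). An inner function on $\triangle_H$ is a bounded holomorphic function on $\triangle_H$ whose boundary values have modulus $1$ a.e. on $\mathbb{T}^2$; equivalently, $(z,w)\mapsto q(zw,w)$ is (extends to) an inner function on $\mathbb{D}^2$. $M_z,M_w$ are multiplication by $z$ and $w$ on $H^2(\triangle_H)$. A submodule is a closed subspace $\mathcal{S}$ invariant under $M_z$ and $M_w$; put $S_z=M_z|_{\mathcal{S}}$, $S_w=M_w|_{\mathcal{S}}$. $\mathcal{S}$ is doubly commuting if $S_z^*S_w=S_wS_z^*$. *)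

theory Defs
  imports "HOL-Analysis.Analysis"
begin

definition hartogs_triangle :: "(complex \<times> complex) set"
  where "hartogs_triangle = {(z, w). cmod z < cmod w \<and> cmod w < 1}"

text \<open>Holomorphy in two variables: at each point the Frechet derivative exists and is
  complex linear.\<close>

definition holomorphic2_on :: "(complex \<times> complex \<Rightarrow> complex) \<Rightarrow> (complex \<times> complex) set \<Rightarrow> bool"
  where "holomorphic2_on f U \<longleftrightarrow>
    (\<forall>p\<in>U. \<exists>a b. (f has_derivative (\<lambda>h. a * fst h + b * snd h)) (at p))"

definition hartogs_mean :: "(complex \<times> complex \<Rightarrow> complex) \<Rightarrow> real \<Rightarrow> real \<Rightarrow> real"
  where "hartogs_mean f s t =
    1 / (4 * pi\<^sup>2) * integral {0..2*pi} (\<lambda>\<gamma>. integral {0..2*pi} (\<lambda>\<theta>.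
      (cmod (f (of_real (s * t) * cis \<theta>, of_real t * cis \<gamma>)))\<^sup>2 * (s * t\<^sup>2)))"

text \<open>Elements of the Hardy space are functions on the Hartogs triangle; they are represented by
  total functions that vanish off the triangle, so that equality of functions is equality on the
  triangle.\<close>

definition hartogs_H2 :: "(complex \<times> complex \<Rightarrow> complex) set"
  where "hartogs_H2 = {f. holomorphic2_on f hartogs_triangle
     \<and> (\<forall>p. p \<notin> hartogs_triangle \<longrightarrow> f p = 0)
     \<and> bdd_above ((\<lambda>(s, t). hartogs_mean f s t) ` ({0<..<1} \<times> {0<..<1}))}"

definition hartogs_norm :: "(complex \<times> complex \<Rightarrow> complex) \<Rightarrow> real"
  where "hartogs_norm f = sqrt (SUP (s, t)\<in>{0<..<1} \<times> {0<..<1}. hartogs_mean f s t)"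

text \<open>The inner product of the Hilbert space is the one determined by its norm, through the
  polarization identity (linear in the first argument).\<close>

definition hartogs_inner ::
    "(complex \<times> complex \<Rightarrow> complex) \<Rightarrow> (complex \<times> complex \<Rightarrow> complex) \<Rightarrow> complex"
  where "hartogs_inner f g =
    (\<Sum>k<4. \<i> ^ k * of_real ((hartogs_norm (\<lambda>p. f p + \<i> ^ k * g p))\<^sup>2)) / 4"

text \<open>The boundary value at a point of the distinguished boundary is the limit along
  \<open>(s t \<zeta>, t \<eta>)\<close> with \<open>s = t = r\<close> tending to 1 from below. (The ray through a point of the
  distinguished boundary does not meet the triangle.) This is the radial limit of
  \<open>(z, w) \<mapsto> q (z w, w)\<close> on the bidisc at \<open>(\<zeta> / \<eta>, \<eta>)\<close>.\<close>

definition hartogs_boundary_value ::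
    "(complex \<times> complex \<Rightarrow> complex) \<Rightarrow> complex \<Rightarrow> complex \<Rightarrow> complex \<Rightarrow> bool"
  where "hartogs_boundary_value q \<zeta> \<eta> l \<longleftrightarrow>
    ((\<lambda>r::real. q (of_real (r\<^sup>2) * \<zeta>, of_real r * \<eta>)) \<longlongrightarrow> l) (at_left 1)"

definition hartogs_inner_function :: "(complex \<times> complex \<Rightarrow> complex) \<Rightarrow> bool"
  where "hartogs_inner_function q \<longleftrightarrow>
     holomorphic2_on q hartogs_triangle \<and> bounded (q ` hartogs_triangle)
     \<and> (AE x in lebesgue_on ({0..2*pi} \<times> {0..2*pi}).
          \<exists>l. hartogs_boundary_value q (cis (fst x)) (cis (snd x)) l \<and> cmod l = 1)"

definition M_z :: "(complex \<times> complex \<Rightarrow> complex) \<Rightarrow> (complex \<times> complex \<Rightarrow> complex)"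
  where "M_z f = (\<lambda>p. fst p * f p)"

definition M_w :: "(complex \<times> complex \<Rightarrow> complex) \<Rightarrow> (complex \<times> complex \<Rightarrow> complex)"
  where "M_w f = (\<lambda>p. snd p * f p)"

definition hartogs_submodule :: "(complex \<times> complex \<Rightarrow> complex) set \<Rightarrow> bool"
  where "hartogs_submodule S \<longleftrightarrow>
     S \<subseteq> hartogs_H2
     \<and> (\<lambda>p. 0) \<in> S
     \<and> (\<forall>f\<in>S. \<forall>g\<in>S. (\<lambda>p. f p + g p) \<in> S)
     \<and> (\<forall>c. \<forall>f\<in>S. (\<lambda>p. c * f p) \<in> S)
     \<and> (\<forall>F f. (\<forall>n::nat. F n \<in> S) \<and> f \<in> hartogs_H2
           \<and> (\<lambda>n. hartogs_norm (\<lambda>p. F n p - f p)) \<longlonglongrightarrow> 0 \<longrightarrow> f \<in> S)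
     \<and> (\<forall>f\<in>S. M_z f \<in> S) \<and> (\<forall>f\<in>S. M_w f \<in> S)"

text \<open>The adjoint of the restriction to \<open>S\<close> of an operator \<open>T\<close>, as an operator on \<open>S\<close>;
  meaningful when \<open>S\<close> is a closed subspace and \<open>T\<close> is bounded and maps \<open>S\<close> to itself.\<close>

definition adjoint_on :: "(complex \<times> complex \<Rightarrow> complex) set \<Rightarrow>
    ((complex \<times> complex \<Rightarrow> complex) \<Rightarrow> (complex \<times> complex \<Rightarrow> complex)) \<Rightarrow>
    (complex \<times> complex \<Rightarrow> complex) \<Rightarrow> (complex \<times> complex \<Rightarrow> complex)"
  where "adjoint_on S T g =
    (THE h. h \<in> S \<and> (\<forall>f\<in>S. hartogs_inner (T f) g = hartogs_inner f h))"

definition doubly_commuting :: "(complex \<times> complex \<Rightarrow> complex) set \<Rightarrow> bool"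
  where "doubly_commuting S \<longleftrightarrow>
    (\<forall>f\<in>S. adjoint_on S M_z (M_w f) = M_w (adjoint_on S M_z f))"

definition mult_H2 :: "(complex \<times> complex \<Rightarrow> complex) \<Rightarrow> (complex \<times> complex \<Rightarrow> complex) set"
  where "mult_H2 q = (\<lambda>f p. q p * f p) ` hartogs_H2"

end

theory Submission
  imports Defs "HOL-Complex_Analysis.Complex_Analysis"
begin

text \<open>
  In the coordinates \<open>\<zeta> = z / w\<close> and \<open>w\<close> the triangle is the bidisc with the line \<open>w = 0\<close> removed, and
  everything becomes a statement about power series. If \<open>f\<close> is in the Hardy space, then
  \<open>w f (\<zeta> w, w) = \<Sum> a (i, j) \<zeta>^i w^j\<close>, and orthogonality of the characters of the torus gives
  \<open>hartogs_mean f s t = s \<Sum> \<bar>a (i, j)\<bar>\<^sup>2 s^(2 i) t^(2 j)\<close>. Hence the squared norm is the sum of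
  all \<open>\<bar>a (i, j)\<bar>\<^sup>2\<close>, the Hardy space is the sequence space \<open>l\<^sup>2\<close> (\<open>hartogs_H2_iff_series\<close>), and the
  monomials \<open>e i j\<close>, equal to \<open>(z / w)^i w^j / w\<close>, form an orthonormal basis.

  On this basis \<open>M_w\<close> raises \<open>j\<close>, while \<open>M_z\<close> raises \<open>i\<close> and \<open>j\<close> at the same time, because
  \<open>z = \<zeta> w\<close>. This coupling destroys double commutation. Indeed \<open>e 1 0\<close> is orthogonal to the range of
  \<open>M_z\<close>, so the adjoint of \<open>M_z\<close> kills it. But \<open>M_w\<close> sends \<open>e 1 0\<close> to \<open>e 1 1\<close>, which is \<open>M_z\<close> applied
  to \<open>e 0 0\<close>, so the adjoint of \<open>M_z\<close> sends \<open>M_w (e 1 0)\<close> to \<open>e 0 0\<close>, which is not zero.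

  Multiplication by an inner function \<open>q\<close> commutes with \<open>M_z\<close> and \<open>M_w\<close> and is an isometry
  (\<open>hartogs_inner_function_isometry\<close>), so it carries this example into the range of \<open>q\<close>. The isometry
  also makes this range closed: a convergent sequence \<open>q g n\<close> comes from a Cauchy sequence \<open>g n\<close>,
  which converges by completeness of \<open>l\<^sup>2\<close>. To prove the isometry, let first \<open>w f\<close> be bounded. The
  means of \<open>q f\<close> and of \<open>f\<close> with \<open>s = t = r\<close> differ by the integral of a bounded multiple of
  \<open>\<bar>q\<bar>\<^sup>2 - 1\<close>, which tends to zero almost everywhere as \<open>r\<close> tends to 1; dominated convergence shows
  that the norms agree. Functions with finitely many coefficients are of this kind and are dense.

  The analytic core is the expansion itself (\<open>hartogs_H2_imp_series\<close>). A priori \<open>w f (\<zeta> w, w)\<close> could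
  have negative powers of \<open>w\<close>. For each \<open>i\<close> the coefficient of \<open>\<zeta>^i\<close> is holomorphic in the punctured
  disc, and the bounded means of \<open>f\<close> bound its \<open>L\<^sup>1\<close> means over circles around 0. That suffices to
  make the singularity at 0 removable.
\<close>

section \<open>Parseval's identity on the torus\<close>

text \<open>The monomial \<open>\<zeta>^i w^j\<close> on the torus with unit radii, for \<open>k = (i, j)\<close>, as a function of
  the arguments \<open>x\<close> of \<open>z = \<zeta> w\<close> and \<open>w\<close>: the argument of \<open>\<zeta>\<close> is then the difference of the two.\<close>

definition torus_char :: "nat \<times> nat \<Rightarrow> real \<times> real \<Rightarrow> complex"
  where "torus_char k x = cis (real (fst k) * (fst x - snd x) + real (snd k) * snd x)"

abbreviation torus_box :: "(real \<times> real) set"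
  where "torus_box \<equiv> cbox (0, 0) (2 * pi, 2 * pi)"

lemma norm_torus_char [simp]: "cmod (torus_char k x) = 1"
  by (simp add: torus_char_def)

lemma continuous_on_torus_char [continuous_intros]: "continuous_on A (torus_char k)"
  unfolding torus_char_def cis_conv_exp by (intro continuous_intros)

lemma integral_cis_int:
  "integral {0..2*pi} (\<lambda>t. cis (of_int m * t)) = (if m = 0 then 2 * of_real pi else 0)"
proof (cases "m = 0")
  case True
  then show ?thesis by (simp add: scaleR_conv_of_real)
next
  case False
  have "((\<lambda>t. cis (of_int m * t)) has_integral
      (cis (of_int m * (2*pi)) / (\<i> * of_int m) - cis (of_int m * 0) / (\<i> * of_int m))) {0..2*pi}"
  proof (intro fundamental_theorem_of_calculus)
    fix t :: real
    have "((\<lambda>z. exp (\<i> * (of_int m * z)) / (\<i> * of_int m)) has_field_derivative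
             exp (\<i> * (of_int m * of_real t))) (at (of_real t))"
      using False by (auto intro!: derivative_eq_intros simp: field_simps)
    from has_vector_derivative_real_field[OF this]
    show "((\<lambda>t. cis (of_int m * t) / (\<i> * of_int m)) has_vector_derivative cis (of_int m * t))
            (at t within {0..2*pi})"
      by (simp add: cis_conv_exp)
  qed simp
  moreover have "cis (of_int m * (2*pi)) = 1"
    using cis_multiple_2pi[of "of_int m"] by (simp add: mult_ac)
  ultimately show ?thesis
    using False by (simp add: integral_unique)
qed

text \<open>The quotient of two characters is \<open>cis (m \<theta>) cis (n \<gamma>)\<close> with integers \<open>m\<close> and \<open>n\<close>, both zero only for
  equal characters, so the double integral is a product of two elementary ones.\<close>

lemma torus_char_orthogonal:
  "integral torus_box (\<lambda>x. torus_char k x * cnj (torus_char l x)) = (if k = l then 4 * of_real pi ^ 2 else 0)"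
proof -
  define m where "m = int (fst k) - int (fst l)"
  define n where "n = (int (snd k) - int (snd l)) - m"
  have eq: "torus_char k x * cnj (torus_char l x) = cis (of_int m * fst x) * cis (of_int n * snd x)" for x
    by (simp add: torus_char_def cis_mult cis_cnj m_def n_def algebra_simps)
  have "integral torus_box (\<lambda>x. torus_char k x * cnj (torus_char l x))
     = integral (cbox 0 (2*pi)) (\<lambda>x. integral (cbox 0 (2*pi)) (\<lambda>y. cis (of_int m * x) * cis (of_int n * y)))"
    unfolding eq by (subst integral_prod_continuous) (auto intro!: continuous_intros simp: cis_conv_exp)
  also have "\<dots> = (if m = 0 then 2 * of_real pi else 0) * (if n = 0 then 2 * of_real pi else 0)"
    by (simp add: integral_cis_int)
  also have "\<dots> = (if k = l then 4 * of_real pi ^ 2 else 0)"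
    by (auto simp: m_def n_def prod_eq_iff power2_eq_square)
  finally show ?thesis .
qed

lemma torus_parseval_finite:
  assumes "finite F"
  shows "integral torus_box (\<lambda>x. (cmod (\<Sum>k\<in>F. b k * torus_char k x))\<^sup>2) = 4 * pi\<^sup>2 * (\<Sum>k\<in>F. (cmod (b k))\<^sup>2)"
proof -
  have int: "(\<lambda>x. c * (torus_char k x * cnj (torus_char l x))) integrable_on torus_box" for k l c
    by (intro integrable_continuous continuous_intros)
  have "of_real (integral torus_box (\<lambda>x. (cmod (\<Sum>k\<in>F. b k * torus_char k x))\<^sup>2))
      = integral torus_box (\<lambda>x. complex_of_real ((cmod (\<Sum>k\<in>F. b k * torus_char k x))\<^sup>2))"
    by (subst integral_linear[OF _ bounded_linear_of_real, symmetric])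
       (auto simp: o_def intro!: integrable_continuous continuous_intros)
  also have "\<dots> = integral torus_box (\<lambda>x. \<Sum>k\<in>F. \<Sum>l\<in>F. b k * cnj (b l) * (torus_char k x * cnj (torus_char l x)))"
    by (intro integral_cong, subst complex_norm_square)
       (simp add: sum_product mult_ac)
  also have "\<dots> = (\<Sum>k\<in>F. \<Sum>l\<in>F. b k * cnj (b l) * (if k = l then 4 * of_real pi ^ 2 else 0))"
    using assms int by (simp add: integral_sum integrable_sum torus_char_orthogonal)
  also have "\<dots> = (\<Sum>k\<in>F. of_real (4 * pi\<^sup>2 * (cmod (b k))\<^sup>2))"
    using assms by (intro sum.cong refl) (simp add: if_distrib flip: complex_norm_square of_real_power cong: if_cong)
  also have "\<dots> = of_real (4 * pi\<^sup>2 * (\<Sum>k\<in>F. (cmod (b k))\<^sup>2))"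
    by (simp add: sum_distrib_left)
  finally show ?thesis
    using of_real_eq_iff by blast
qed

text \<open>Absolute summability makes the finite partial sums converge uniformly on the torus, so
  the finite identity passes to the limit under the integral.\<close>

lemma torus_parseval:
  assumes "(\<lambda>k. cmod (b k)) summable_on UNIV"
  shows "((\<lambda>k. (cmod (b k))\<^sup>2) has_sum
           (integral torus_box (\<lambda>x. (cmod (\<Sum>\<^sub>\<infinity>k. b k * torus_char k x))\<^sup>2) / (4 * pi\<^sup>2))) UNIV"
proof -
  have u: "uniform_limit torus_box (\<lambda>F x. \<Sum>k\<in>F. b k * torus_char k x)
             (\<lambda>x. \<Sum>\<^sub>\<infinity>k. b k * torus_char k x) (finite_subsets_at_top UNIV)"
    by (rule Weierstrass_m_test_general[OF _ assms]) (simp add: norm_mult)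
  have c: "continuous_on torus_box (\<lambda>x. \<Sum>\<^sub>\<infinity>k. b k * torus_char k x)"
    by (rule uniform_limit_theorem[OF _ u]) (auto intro!: continuous_intros always_eventually)
  have bdd: "bounded ((\<lambda>x. cmod (\<Sum>\<^sub>\<infinity>k. b k * torus_char k x)) ` torus_box)"
    by (intro compact_imp_bounded compact_continuous_image continuous_intros c) auto
  have u1: "uniform_limit torus_box (\<lambda>F x. cmod (\<Sum>k\<in>F. b k * torus_char k x))
             (\<lambda>x. cmod (\<Sum>\<^sub>\<infinity>k. b k * torus_char k x)) (finite_subsets_at_top UNIV)"
    by (intro uniform_limit_intros u)
  have u2: "uniform_limit torus_box (\<lambda>F x. (cmod (\<Sum>k\<in>F. b k * torus_char k x))\<^sup>2)
             (\<lambda>x. (cmod (\<Sum>\<^sub>\<infinity>k. b k * torus_char k x))\<^sup>2) (finite_subsets_at_top UNIV)"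
    unfolding power2_eq_square by (rule uniform_lim_mult[OF u1 u1 bdd bdd])
  obtain I J where I: "\<And>F. ((\<lambda>x. (cmod (\<Sum>k\<in>F. b k * torus_char k x))\<^sup>2) has_integral I F) torus_box"
    and J: "((\<lambda>x. (cmod (\<Sum>\<^sub>\<infinity>k. b k * torus_char k x))\<^sup>2) has_integral J) torus_box"
    and lim: "(I \<longlongrightarrow> J) (finite_subsets_at_top UNIV)"
    by (rule uniform_limit_integral_cbox[OF u2]) (auto intro!: continuous_intros)
  have "\<forall>\<^sub>F F in finite_subsets_at_top UNIV. I F / (4 * pi\<^sup>2) = (\<Sum>k\<in>F. (cmod (b k))\<^sup>2)"
    using torus_parseval_finite[of _ b] integral_unique[OF I]
    by (intro eventually_finite_subsets_at_top_weakI) (auto simp: field_simps)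
  then have "((\<lambda>F. \<Sum>k\<in>F. (cmod (b k))\<^sup>2) \<longlongrightarrow> J / (4 * pi\<^sup>2)) (finite_subsets_at_top UNIV)"
    using tendsto_divide[OF lim tendsto_const, of "4 * pi\<^sup>2"] by (simp add: tendsto_cong)
  then show ?thesis
    using J by (simp add: has_sum_def integral_unique)
qed

section \<open>Holomorphic functions on the Hartogs triangle\<close>

lemma holomorphic2_onE:
  assumes "holomorphic2_on f U" "p \<in> U"
  obtains a b where "(f has_derivative (\<lambda>h. a * fst h + b * snd h)) (at p)"
  using assms unfolding holomorphic2_on_def by blast

lemma holomorphic2_on_imp_continuous_on:
  assumes "holomorphic2_on f U"
  shows "continuous_on U f"
  using assms unfolding holomorphic2_on_def
  by (meson continuous_at_imp_continuous_on has_derivative_continuous)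

lemma holomorphic2_on_fst:
  assumes "holomorphic2_on f U" and "\<And>z. z \<in> A \<Longrightarrow> (z, w) \<in> U"
  shows "(\<lambda>z. f (z, w)) holomorphic_on A"
  unfolding holomorphic_on_def
proof
  fix z assume "z \<in> A"
  then obtain a b where "(f has_derivative (\<lambda>h. a * fst h + b * snd h)) (at (z, w))"
    using assms unfolding holomorphic2_on_def by blast
  then have "((f \<circ> (\<lambda>z. (z, w))) has_derivative ((\<lambda>h. a * fst h + b * snd h) \<circ> (\<lambda>h. (h, 0)))) (at z)"
    by (intro diff_chain_at) (auto intro!: derivative_eq_intros)
  then have "((\<lambda>z. f (z, w)) has_field_derivative a) (at z)"
    by (simp add: has_field_derivative_def o_def)
  then show "(\<lambda>z. f (z, w)) field_differentiable (at z within A)"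
    using field_differentiable_at_within field_differentiable_def by blast
qed

lemma holomorphic2_on_snd:
  assumes "holomorphic2_on f U" and "\<And>w. w \<in> A \<Longrightarrow> (z, w) \<in> U"
  shows "(\<lambda>w. f (z, w)) holomorphic_on A"
  unfolding holomorphic_on_def
proof
  fix w assume "w \<in> A"
  then obtain a b where "(f has_derivative (\<lambda>h. a * fst h + b * snd h)) (at (z, w))"
    using assms unfolding holomorphic2_on_def by blast
  then have "((f \<circ> (\<lambda>w. (z, w))) has_derivative ((\<lambda>h. a * fst h + b * snd h) \<circ> (\<lambda>h. (0, h)))) (at w)"
    by (intro diff_chain_at) (auto intro!: derivative_eq_intros)
  then have "((\<lambda>w. f (z, w)) has_field_derivative b) (at w)"
    by (simp add: has_field_derivative_def o_def)
  then show "(\<lambda>w. f (z, w)) field_differentiable (at w within A)"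
    using field_differentiable_at_within field_differentiable_def by blast
qed

lemma holomorphic2_on_mult:
  assumes "holomorphic2_on f U" "holomorphic2_on g U"
  shows "holomorphic2_on (\<lambda>p. f p * g p) U"
  unfolding holomorphic2_on_def
proof
  fix p assume p: "p \<in> U"
  obtain a b where f: "(f has_derivative (\<lambda>h. a * fst h + b * snd h)) (at p)"
    using holomorphic2_onE[OF assms(1) p] .
  obtain c d where g: "(g has_derivative (\<lambda>h. c * fst h + d * snd h)) (at p)"
    using holomorphic2_onE[OF assms(2) p] .
  have "((\<lambda>p. f p * g p) has_derivative
      (\<lambda>h. (f p * c + a * g p) * fst h + (f p * d + b * g p) * snd h)) (at p)"
    by (rule has_derivative_eq_rhs[OF has_derivative_mult[OF f g]]) (simp add: fun_eq_iff algebra_simps)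
  then show "\<exists>a b. ((\<lambda>p. f p * g p) has_derivative (\<lambda>h. a * fst h + b * snd h)) (at p)"
    by blast
qed

lemma open_hartogs_triangle: "open hartogs_triangle"
proof -
  have "hartogs_triangle = {p. cmod (fst p) < cmod (snd p)} \<inter> {p. cmod (snd p) < 1}"
    by (auto simp: hartogs_triangle_def)
  moreover have "open {p::complex\<times>complex. cmod (fst p) < cmod (snd p)}" "open {p::complex\<times>complex. cmod (snd p) < 1}"
    by (intro open_Collect_less continuous_intros)+
  ultimately show ?thesis by (metis open_Int)
qed

lemma hartogs_triangle_polar:
  assumes "cmod \<zeta> < 1" "0 < cmod w" "cmod w < 1"
  shows "(\<zeta> * w, w) \<in> hartogs_triangle"
  using assms by (simp add: hartogs_triangle_def norm_mult)

lemma hartogs_torus_mem: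
  assumes "0 < s" "s < 1" "0 < t" "t < 1"
  shows "(of_real (s * t) * cis \<theta>, of_real t * cis \<gamma>) \<in> hartogs_triangle"
  using assms by (simp add: hartogs_triangle_def norm_mult)

lemma continuous_on_hartogs_torus:
  assumes "continuous_on hartogs_triangle f" "0 < s" "s < 1" "0 < t" "t < 1"
  shows "continuous_on A (\<lambda>x. f (of_real (s * t) * cis (fst x), of_real t * cis (snd x)))"
  by (intro continuous_on_compose2[OF assms(1)] continuous_intros)
     (use hartogs_torus_mem assms in auto)

text \<open>One integral over the square of angles is easier to handle than the iterated integral of
  the definition: limit theorems apply to it at once.\<close>

lemma hartogs_mean_eq_integral_torus:
  assumes "continuous_on hartogs_triangle f" "0 < s" "s < 1" "0 < t" "t < 1"
  shows "hartogs_mean f s t = 1 / (4 * pi\<^sup>2) * integral torus_box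
    (\<lambda>x. (cmod (f (of_real (s * t) * cis (fst x), of_real t * cis (snd x))))\<^sup>2 * (s * t\<^sup>2))"
proof -
  let ?h = "\<lambda>\<theta> \<gamma>. (cmod (f (of_real (s * t) * cis \<theta>, of_real t * cis \<gamma>)))\<^sup>2 * (s * t\<^sup>2)"
  have c: "continuous_on A (\<lambda>x. ?h (fst x) (snd x))" for A
    by (intro continuous_intros continuous_on_hartogs_torus assms)
  have "integral torus_box (\<lambda>x. ?h (fst x) (snd x))
      = integral (cbox 0 (2*pi)) (\<lambda>\<theta>. integral (cbox 0 (2*pi)) (\<lambda>\<gamma>. ?h \<theta> \<gamma>))"
    using integral_prod_continuous[OF c] by simp
  also have "\<dots> = integral (cbox 0 (2*pi)) (\<lambda>\<gamma>. integral (cbox 0 (2*pi)) (\<lambda>\<theta>. ?h \<theta> \<gamma>))"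
    by (rule integral_swap_continuous) (subst case_prod_unfold, rule c)
  finally show ?thesis
    unfolding hartogs_mean_def by (simp only: box_real)
qed

section \<open>Power series in \<open>z / w\<close> and \<open>w\<close>\<close>

text \<open>The factor \<open>w\<close> turns the basis functions \<open>(z / w)^i w^j / w\<close> into the monomials \<open>\<zeta>^i w^j\<close>.
  The value at \<open>w = 0\<close> is not prescribed, as this line does not meet the triangle.\<close>

definition hartogs_series :: "(complex \<times> complex \<Rightarrow> complex) \<Rightarrow> (nat \<times> nat \<Rightarrow> complex) \<Rightarrow> bool"
  where "hartogs_series f a \<longleftrightarrow> (\<forall>\<zeta> w. cmod \<zeta> < 1 \<longrightarrow> 0 < cmod w \<longrightarrow> cmod w < 1 \<longrightarrow>
    ((\<lambda>k. a k * \<zeta> ^ fst k * w ^ snd k) has_sum (w * f (\<zeta> * w, w))) UNIV)"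

lemma hartogs_series_abs_summable:
  assumes "hartogs_series f a" "0 < s" "s < 1" "0 < t" "t < 1"
  shows "(\<lambda>k. cmod (a k) * s ^ fst k * t ^ snd k) summable_on UNIV"
proof -
  have "((\<lambda>k. a k * of_real s ^ fst k * of_real t ^ snd k) has_sum (of_real t * f (of_real s * of_real t, of_real t))) UNIV"
    using assms(1)[unfolded hartogs_series_def, rule_format, of "of_real s" "of_real t"] assms(2-) by simp
  then have "(\<lambda>k. a k * of_real s ^ fst k * of_real t ^ snd k) summable_on UNIV"
    unfolding summable_on_def by blast
  then show ?thesis
    using assms by (simp add: summable_on_iff_abs_summable_on_complex norm_mult norm_power)
qed

text \<open>On the torus with radii \<open>s t\<close> and \<open>t\<close> the variable \<open>\<zeta>\<close> has modulus \<open>s\<close>, so the coefficients of the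
  Fourier series of \<open>w f\<close> are \<open>a (i, j) s^i t^j\<close>. The weight \<open>s t\<^sup>2\<close> of the mean absorbs \<open>\<bar>w\<bar>\<^sup>2\<close>
  and leaves one factor \<open>s\<close>, hence the exponent \<open>2 i + 1\<close>.\<close>

lemma hartogs_mean_has_sum:
  assumes ser: "hartogs_series f a" and cont: "continuous_on hartogs_triangle f"
    and st: "0 < s" "s < 1" "0 < t" "t < 1"
  shows "((\<lambda>k. (cmod (a k))\<^sup>2 * (s ^ (2 * fst k + 1) * t ^ (2 * snd k))) has_sum hartogs_mean f s t) UNIV"
proof -
  define b where "b k = a k * of_real s ^ fst k * of_real t ^ snd k" for k
  have "(\<lambda>k. cmod (b k)) summable_on UNIV"
    using hartogs_series_abs_summable[OF ser st] st by (simp add: b_def norm_mult norm_power)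
  from torus_parseval[OF this]
  have P: "((\<lambda>k. (cmod (b k))\<^sup>2) has_sum
           (integral torus_box (\<lambda>x. (cmod (\<Sum>\<^sub>\<infinity>k. b k * torus_char k x))\<^sup>2) / (4 * pi\<^sup>2))) UNIV" .
  have eq: "(\<Sum>\<^sub>\<infinity>k. b k * torus_char k x)
      = of_real t * cis (snd x) * f (of_real (s * t) * cis (fst x), of_real t * cis (snd x))" for x
  proof -
    let ?\<zeta> = "of_real s * cis (fst x - snd x)" and ?w = "of_real t * cis (snd x)"
    have "((\<lambda>k. a k * ?\<zeta> ^ fst k * ?w ^ snd k) has_sum (?w * f (?\<zeta> * ?w, ?w))) UNIV"
      using ser st unfolding hartogs_series_def by (simp add: norm_mult)
    moreover have "?\<zeta> * ?w = of_real (s * t) * cis (fst x)"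
      by (simp add: cis_mult mult_ac)
    moreover have "a k * ?\<zeta> ^ fst k * ?w ^ snd k = b k * torus_char k x" for k
      by (simp add: b_def torus_char_def power_mult_distrib Complex.DeMoivre cis_mult[symmetric] mult_ac)
    ultimately show ?thesis
      by (simp add: infsumI)
  qed
  have "s * (integral torus_box (\<lambda>x. (cmod (\<Sum>\<^sub>\<infinity>k. b k * torus_char k x))\<^sup>2) / (4 * pi\<^sup>2))
      = integral torus_box (\<lambda>x. s * (cmod (\<Sum>\<^sub>\<infinity>k. b k * torus_char k x))\<^sup>2) / (4 * pi\<^sup>2)"
    by simp
  also have "\<dots> = hartogs_mean f s t"
    unfolding eq hartogs_mean_eq_integral_torus[OF cont st]
    by (simp add: norm_mult power_mult_distrib mult_ac)
  finally show ?thesis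
    using has_sum_cmult_right[OF P, of s] st
    by (simp add: b_def norm_mult norm_power power_mult_distrib power_mult[symmetric] mult_ac)
qed

text \<open>The terms of a differentiated geometric series on a disc are dominated by those of a
  geometric series on a larger disc. The left-hand side times \<open>r - \<rho>\<close> is at most \<open>r^n - \<rho>^n\<close>, as one sees from the factorization of that difference.\<close>

lemma nat_times_power_le_geometric:
  fixes r \<rho> :: real
  assumes "0 \<le> \<rho>" "\<rho> < r"
  shows "real n * \<rho> ^ (n - 1) \<le> r ^ n / (r - \<rho>)"
proof -
  have "real n * \<rho> ^ (n - 1) * (r - \<rho>) \<le> r ^ n - \<rho> ^ n"
  proof (induction n)
    case 0
    show ?case by simp
  next
    case (Suc n)
    have "real n * \<rho> ^ n = \<rho> * (real n * \<rho> ^ (n - 1))"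
      by (cases n) auto
    then have "real (Suc n) * \<rho> ^ (Suc n - 1) = \<rho> * (real n * \<rho> ^ (n - 1)) + \<rho> ^ n"
      by (simp add: algebra_simps)
    then have "real (Suc n) * \<rho> ^ (Suc n - 1) * (r - \<rho>)
        = \<rho> * (real n * \<rho> ^ (n - 1) * (r - \<rho>)) + \<rho> ^ n * (r - \<rho>)"
      by (simp only: distrib_right mult.assoc)
    also have "\<dots> \<le> \<rho> * (r ^ n - \<rho> ^ n) + \<rho> ^ n * (r - \<rho>)"
      using Suc assms by (intro add_right_mono mult_left_mono) auto
    also have "\<dots> = r ^ Suc n - \<rho> ^ Suc n - (r - \<rho>) * (r ^ n - \<rho> ^ n)"
      by (simp add: algebra_simps)
    also have "\<dots> \<le> r ^ Suc n - \<rho> ^ Suc n"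
      using assms by (simp add: power_mono)
    finally show ?case .
  qed
  also have "\<dots> \<le> r ^ n"
    using assms by simp
  finally show ?thesis
    using assms by (simp add: field_simps)
qed

text \<open>Termwise differentiation on a smaller bidisc, where the series of both partial derivatives
  converge uniformly by comparison on a slightly larger bidisc.\<close>

lemma double_power_series_holomorphic2:
  fixes a :: "nat \<times> nat \<Rightarrow> complex"
  assumes "\<And>r. 0 < r \<Longrightarrow> r < 1 \<Longrightarrow> (\<lambda>k. cmod (a k) * r ^ fst k * r ^ snd k) summable_on UNIV"
  shows "holomorphic2_on (\<lambda>x. \<Sum>\<^sub>\<infinity>k. a k * fst x ^ fst k * snd x ^ snd k) (ball 0 1 \<times> ball 0 1)"
  unfolding holomorphic2_on_def
proof
  fix x0 :: "complex \<times> complex" assume x0: "x0 \<in> ball 0 1 \<times> ball 0 1"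
  define \<rho> where "\<rho> = (1 + max (cmod (fst x0)) (cmod (snd x0))) / 2"
  define r where "r = (1 + \<rho>) / 2"
  have \<rho>: "0 < \<rho>" "\<rho> < r" "r < 1" and x0\<rho>: "cmod (fst x0) < \<rho>" "cmod (snd x0) < \<rho>"
    using x0 by (auto simp: \<rho>_def r_def mem_Times_iff max_def add_pos_nonneg)
  define S where "S = ball (0::complex) \<rho> \<times> ball (0::complex) \<rho>"
  have S: "convex S" "open S" "x0 \<in> S"
    using x0\<rho> by (auto simp: S_def mem_Times_iff intro!: convex_Times open_Times)
  \<comment> \<open>The theorem on termwise differentiation is about sequences, so the index pairs are enumerated.\<close>
  define e :: "nat \<Rightarrow> nat \<times> nat" where "e = prod_decode"
  have bij: "bij_betw e UNIV UNIV"
    using bij_prod_decode by (simp add: e_def)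
  define M where "M n = cmod (a (e n)) * r ^ fst (e n) * r ^ snd (e n)" for n
  have sumM: "summable M"
  proof -
    have "(\<lambda>k. cmod (a k) * r ^ fst k * r ^ snd k) summable_on UNIV"
      using assms \<rho> by simp
    then have "M summable_on UNIV"
      unfolding M_def by (subst summable_on_reindex_bij_betw[OF bij]) 
    then show ?thesis
      by (rule summable_on_imp_summable)
  qed
  define f where "f n x = a (e n) * fst x ^ fst (e n) * snd x ^ snd (e n)" for n x
  define A where "A n x = a (e n) * (of_nat (fst (e n)) * fst x ^ (fst (e n) - 1)) * snd x ^ snd (e n)" for n x
  define B where "B n x = a (e n) * fst x ^ fst (e n) * (of_nat (snd (e n)) * snd x ^ (snd (e n) - 1))" for n x
  have pw: "cmod z ^ m \<le> r ^ m" if "cmod z < \<rho>" for z m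
    using that \<rho> by (intro power_mono) auto
  have pw': "real m * cmod z ^ (m - 1) \<le> r ^ m / (r - \<rho>)" if "cmod z < \<rho>" for z m
  proof -
    have "real m * cmod z ^ (m - 1) \<le> real m * \<rho> ^ (m - 1)"
      using that by (intro mult_left_mono power_mono) auto
    also have "\<dots> \<le> r ^ m / (r - \<rho>)"
      using \<rho> by (intro nat_times_power_le_geometric) auto
    finally show ?thesis .
  qed
  have normA: "norm (A n x) \<le> M n / (r - \<rho>)" if "x \<in> S" for n x
  proof -
    have "norm (A n x) = cmod (a (e n)) * (real (fst (e n)) * cmod (fst x) ^ (fst (e n) - 1)) * cmod (snd x) ^ snd (e n)"
      by (simp add: A_def norm_mult norm_power)
    also have "\<dots> \<le> cmod (a (e n)) * (r ^ fst (e n) / (r - \<rho>)) * r ^ snd (e n)"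
      using that \<rho> by (intro mult_mono pw pw') (auto simp: S_def mem_Times_iff)
    finally show ?thesis by (simp add: M_def)
  qed
  have normB: "norm (B n x) \<le> M n / (r - \<rho>)" if "x \<in> S" for n x
  proof -
    have "norm (B n x) = cmod (a (e n)) * cmod (fst x) ^ fst (e n) * (real (snd (e n)) * cmod (snd x) ^ (snd (e n) - 1))"
      by (simp add: B_def norm_mult norm_power)
    also have "\<dots> \<le> cmod (a (e n)) * r ^ fst (e n) * (r ^ snd (e n) / (r - \<rho>))"
      using that \<rho> by (intro mult_mono pw pw') (auto simp: S_def mem_Times_iff)
    finally show ?thesis by (simp add: M_def)
  qed
  have uA: "uniform_limit S (\<lambda>n x. \<Sum>i<n. A i x) (\<lambda>x. \<Sum>i. A i x) sequentially"
    by (rule Weierstrass_m_test[OF normA]) (use sumM in \<open>auto intro: summable_divide\<close>)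
  have uB: "uniform_limit S (\<lambda>n x. \<Sum>i<n. B i x) (\<lambda>x. \<Sum>i. B i x) sequentially"
    by (rule Weierstrass_m_test[OF normB]) (use sumM in \<open>auto intro: summable_divide\<close>)
  have hs: "((\<lambda>k. a k * fst x ^ fst k * snd x ^ snd k) has_sum
      (\<Sum>\<^sub>\<infinity>k. a k * fst x ^ fst k * snd x ^ snd k)) UNIV" if "x \<in> S" for x
  proof -
    have "(\<lambda>k. cmod (a k * fst x ^ fst k * snd x ^ snd k)) summable_on UNIV"
    proof (rule Infinite_Sum.abs_summable_on_comparison_test'[where g = "\<lambda>k. cmod (a k) * r ^ fst k * r ^ snd k"])
      show "(\<lambda>k. cmod (a k) * r ^ fst k * r ^ snd k) summable_on UNIV"
        using assms \<rho> by simp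
      show "cmod (a k * fst x ^ fst k * snd x ^ snd k) \<le> cmod (a k) * r ^ fst k * r ^ snd k" for k
        unfolding norm_mult norm_power using that \<rho>
        by (intro mult_mono pw) (auto simp: S_def mem_Times_iff)
    qed
    then show ?thesis
      by (rule has_sum_infsum[OF abs_summable_summable])
  qed
  have sums: "(\<lambda>n. f n x) sums (\<Sum>\<^sub>\<infinity>k. a k * fst x ^ fst k * snd x ^ snd k)" if "x \<in> S" for x
    using hs[OF that] unfolding f_def
    by (intro has_sum_imp_sums) (subst has_sum_reindex_bij_betw[OF bij])
  have "\<exists>g. \<forall>x\<in>S. (\<lambda>n. f n x) sums (g x) \<and>
      (g has_derivative (\<lambda>h. (\<Sum>i. A i x) * fst h + (\<Sum>i. B i x) * snd h)) (at x within S)"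
  proof (rule has_derivative_series[where f' = "\<lambda>n x h. A n x * fst h + B n x * snd h"])
    show "(f n has_derivative (\<lambda>h. A n x * fst h + B n x * snd h)) (at x within S)" for n x
      unfolding f_def A_def B_def
      by (auto intro!: derivative_eq_intros simp: algebra_simps)
    fix \<epsilon> :: real assume \<epsilon>: "\<epsilon> > 0"
    have "\<forall>\<^sub>F n in sequentially. \<forall>x\<in>S. dist (\<Sum>i<n. A i x) (\<Sum>i. A i x) < \<epsilon> / 2"
      "\<forall>\<^sub>F n in sequentially. \<forall>x\<in>S. dist (\<Sum>i<n. B i x) (\<Sum>i. B i x) < \<epsilon> / 2"
      using uniform_limitD[OF uA, of "\<epsilon> / 2"] uniform_limitD[OF uB, of "\<epsilon> / 2"] \<epsilon> by auto
    then show "\<forall>\<^sub>F n in sequentially. \<forall>x\<in>S. \<forall>h.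
        norm ((\<Sum>i<n. A i x * fst h + B i x * snd h) - ((\<Sum>i. A i x) * fst h + (\<Sum>i. B i x) * snd h)) \<le> \<epsilon> * norm h"
    proof eventually_elim
      case (elim n)
      show ?case
      proof (intro ballI allI)
        fix x and h :: "complex \<times> complex" assume x: "x \<in> S"
        have "norm ((\<Sum>i<n. A i x * fst h + B i x * snd h) - ((\<Sum>i. A i x) * fst h + (\<Sum>i. B i x) * snd h))
            = norm (((\<Sum>i<n. A i x) - (\<Sum>i. A i x)) * fst h + ((\<Sum>i<n. B i x) - (\<Sum>i. B i x)) * snd h)"
          by (simp add: sum.distrib left_diff_distrib add_diff_add flip: sum_distrib_right)
        also have "\<dots> \<le> \<epsilon> / 2 * norm h + \<epsilon> / 2 * norm h"
        proof (rule order_trans[OF norm_triangle_ineq], unfold norm_mult, intro add_mono mult_mono)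
          show "cmod ((\<Sum>i<n. A i x) - (\<Sum>i. A i x)) \<le> \<epsilon> / 2" "cmod ((\<Sum>i<n. B i x) - (\<Sum>i. B i x)) \<le> \<epsilon> / 2"
            using elim x by (auto simp: dist_norm intro: less_imp_le)
          show "cmod (fst h) \<le> norm h" "cmod (snd h) \<le> norm h"
            using norm_fst_le[of "fst h" "snd h"] norm_snd_le[of "snd h" "fst h"] by auto
        qed (use \<epsilon> in auto)
        finally show "norm ((\<Sum>i<n. A i x * fst h + B i x * snd h) - ((\<Sum>i. A i x) * fst h + (\<Sum>i. B i x) * snd h)) \<le> \<epsilon> * norm h"
          by simp
      qed
    qed
  qed (use S(1,3) in \<open>auto intro!: sums[OF S(3)]\<close>)
  then obtain g where g: "\<And>x. x \<in> S \<Longrightarrow> (\<lambda>n. f n x) sums (g x)"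
    "(g has_derivative (\<lambda>h. (\<Sum>i. A i x0) * fst h + (\<Sum>i. B i x0) * snd h)) (at x0 within S)"
    using S by blast
  have "((\<lambda>x. \<Sum>\<^sub>\<infinity>k. a k * fst x ^ fst k * snd x ^ snd k) has_derivative
      (\<lambda>h. (\<Sum>i. A i x0) * fst h + (\<Sum>i. B i x0) * snd h)) (at x0)"
  proof (rule has_derivative_transform_within_open[OF _ S(2,3)])
    show "(g has_derivative (\<lambda>h. (\<Sum>i. A i x0) * fst h + (\<Sum>i. B i x0) * snd h)) (at x0)"
      using g(2) S at_within_open by metis
    show "g x = (\<Sum>\<^sub>\<infinity>k. a k * fst x ^ fst k * snd x ^ snd k)" if "x \<in> S" for x
      using g(1)[OF that] sums[OF that] sums_unique2 by blast
  qed
  then show "\<exists>u v. ((\<lambda>x. \<Sum>\<^sub>\<infinity>k. a k * fst x ^ fst k * snd x ^ snd k) has_derivative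
      (\<lambda>h. u * fst h + v * snd h)) (at x0)"
    by blast
qed

lemma hartogs_series_imp_holomorphic2:
  assumes "hartogs_series f a"
  shows "holomorphic2_on f hartogs_triangle"
  unfolding holomorphic2_on_def
proof
  fix p assume p: "p \<in> hartogs_triangle"
  define P where "P x = (\<Sum>\<^sub>\<infinity>k. a k * fst x ^ fst k * snd x ^ snd k)" for x
  define \<phi> where "\<phi> p = (fst p / snd p, snd p)" for p :: "complex \<times> complex"
  have hol: "holomorphic2_on P (ball 0 1 \<times> ball 0 1)"
    unfolding P_def by (rule double_power_series_holomorphic2) (rule hartogs_series_abs_summable[OF assms])
  have nz: "snd p \<noteq> 0" using p by (auto simp: hartogs_triangle_def)
  have in_bidisc: "\<phi> p \<in> ball 0 1 \<times> ball 0 1"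
    using p by (auto simp: hartogs_triangle_def \<phi>_def norm_divide divide_simps)
  obtain u v where uv: "(P has_derivative (\<lambda>h. u * fst h + v * snd h)) (at (\<phi> p))"
    using holomorphic2_onE[OF hol in_bidisc] .
  have d\<phi>: "(\<phi> has_derivative (\<lambda>h. (fst h / snd p - fst p * snd h / (snd p)\<^sup>2, snd h))) (at p)"
    unfolding \<phi>_def using nz
    by (auto intro!: derivative_eq_intros simp: field_simps power2_eq_square)
  have dP: "((\<lambda>x. P (\<phi> x)) has_derivative
      (\<lambda>h. u * (fst h / snd p - fst p * snd h / (snd p)\<^sup>2) + v * snd h)) (at p)"
    using diff_chain_at[OF d\<phi> uv] by (simp add: o_def)
  have "((\<lambda>x. P (\<phi> x) / snd x) has_derivative
      (\<lambda>h. (u / (snd p)\<^sup>2) * fst h + ((v - u * fst p / (snd p)\<^sup>2) / snd p - P (\<phi> p) / (snd p)\<^sup>2) * snd h)) (at p)"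
  proof (rule has_derivative_eq_rhs[OF has_derivative_divide'[OF dP has_derivative_snd[OF has_derivative_ident] nz]])
    have quot: "((u * (x / w - z * y / w\<^sup>2) + v * y) * w - c * y) / (w * w)
        = (u / w\<^sup>2) * x + ((v - u * z / w\<^sup>2) / w - c / w\<^sup>2) * y" if "w \<noteq> 0" for x y z w c
      using that by (simp add: field_simps power2_eq_square)
    show "(\<lambda>h. ((u * (fst h / snd p - fst p * snd h / (snd p)\<^sup>2) + v * snd h) * snd p - P (\<phi> p) * snd h)
          / (snd p * snd p))
      = (\<lambda>h. (u / (snd p)\<^sup>2) * fst h + ((v - u * fst p / (snd p)\<^sup>2) / snd p - P (\<phi> p) / (snd p)\<^sup>2) * snd h)"
      by (intro ext quot nz)
  qed
  moreover have "P (\<phi> x) / snd x = f x" if "x \<in> hartogs_triangle" for x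
  proof -
    have nz: "snd x \<noteq> 0" using that by (auto simp: hartogs_triangle_def)
    have "((\<lambda>k. a k * (fst x / snd x) ^ fst k * snd x ^ snd k) has_sum (snd x * f ((fst x / snd x) * snd x, snd x))) UNIV"
      by (rule assms[unfolded hartogs_series_def, rule_format])
         (use that in \<open>auto simp: hartogs_triangle_def norm_divide divide_simps\<close>)
    then show ?thesis
      using nz by (simp add: P_def \<phi>_def infsumI)
  qed
  ultimately have "(f has_derivative
      (\<lambda>h. (u / (snd p)\<^sup>2) * fst h + ((v - u * fst p / (snd p)\<^sup>2) / snd p - P (\<phi> p) / (snd p)\<^sup>2) * snd h)) (at p)"
    using has_derivative_transform_within_open[OF _ open_hartogs_triangle p] by blast
  then show "\<exists>a b. (f has_derivative (\<lambda>h. a * fst h + b * snd h)) (at p)"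
    by blast
qed

section \<open>Removing the singularity on the line \<open>w = 0\<close>\<close>

lemma contour_integral_circlepath_cis:
  "contour_integral (circlepath z r) f = integral {0..2*pi} (\<lambda>t. f (z + r * cis t) * r * \<i> * cis t)"
  unfolding circlepath_def by (rule contour_integral_part_circlepath_eq) simp

lemma norm_contour_integral_circlepath_le:
  assumes "0 < r" and "continuous_on (sphere 0 r) f"
  shows "cmod (contour_integral (circlepath 0 r) f) \<le> r * integral {0..2*pi} (\<lambda>t. cmod (f (r * cis t)))"
proof -
  have c: "continuous_on {0..2*pi} (\<lambda>t. f (r * cis t))"
    by (intro continuous_on_compose2[OF assms(2)] continuous_intros) (use assms in \<open>auto simp: norm_mult\<close>)
  have "cmod (integral {0..2*pi} (\<lambda>t. f (r * cis t) * r * \<i> * cis t))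
      \<le> integral {0..2*pi} (\<lambda>t. r * cmod (f (r * cis t)))"
    by (intro integral_norm_bound_integral integrable_continuous_real continuous_intros c)
       (use assms in \<open>auto simp: norm_mult\<close>)
  then show ?thesis
    by (simp add: contour_integral_circlepath_cis)
qed

text \<open>Cauchy's formula for an annulus writes \<open>g w\<close> as an integral over a fixed circle minus
  one over a circle of radius \<open>r\<close> around 0. The latter is at most \<open>r\<close> times a constant, by the bound on the mean of \<open>g\<close>, and
  vanishes as \<open>r\<close> tends to 0. The remaining integral is holomorphic at 0 as well.\<close>

lemma removable_singularity_bounded_circle_means:
  assumes hol: "g holomorphic_on ball 0 1 - {0}"
    and bound: "\<And>r. 0 < r \<Longrightarrow> r < 1 \<Longrightarrow> integral {0..2*pi} (\<lambda>t. cmod (g (of_real r * cis t))) \<le> K"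
  obtains h where "h holomorphic_on ball 0 1" "\<And>w. w \<in> ball 0 1 - {0} \<Longrightarrow> h w = g w"
proof -
  \<comment> \<open>The radius of the fixed circle; every value below 1 would do.\<close>
  define R :: real where "R = 1 / 2"
  have gc: "continuous_on (sphere 0 r) g" if "0 < r" "r < 1" for r
    using that by (intro continuous_on_subset[OF holomorphic_on_imp_continuous_on[OF hol]]) auto
  have cauchy: "((\<lambda>u. g u / (u - w)) has_contour_integral 2 * of_real pi * \<i> * g w) (circlepath 0 R)"
    if w: "0 < cmod w" "cmod w < R" for w
  proof -
    \<comment> \<open>This quotient is holomorphic in the punctured disc, so its integrals over all circles
      around 0 have the same value \<open>E\<close>. Small circles do not enclose \<open>w\<close> and show that \<open>E = 0\<close>.\<close>
    define \<phi> where "\<phi> u = (if u = w then deriv g w else (g u - g w) / (u - w))" for u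
    have hol\<phi>: "\<phi> holomorphic_on ball 0 1 - {0}"
      unfolding \<phi>_def by (intro pole_lemma_open hol open_delete open_ball)
    define E where "E = contour_integral (circlepath 0 R) \<phi>"
    have E_small: "cmod E \<le> 2 * K / cmod w * r" if r: "0 < r" "r < cmod w / 2" for r
    proof -
      have rR: "r \<le> R" "r < 1" "cball 0 R \<subseteq> ball (0::complex) 1"
        using r w by (auto simp: R_def)
      have int: "\<phi> contour_integrable_on circlepath 0 r" "E = contour_integral (circlepath 0 r) \<phi>"
        using contour_integral_circlepath_eq[OF _ hol\<phi> r(1) rR(1) rR(3)] by (auto simp: E_def)
      have "((\<lambda>u. 1 / (u - w)) has_contour_integral 0) (circlepath 0 r)"
        by (rule Cauchy_theorem_disc_simple[where a = 0 and e = "cmod w"])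
           (use r in \<open>auto intro!: holomorphic_intros\<close>)
      then have "((\<lambda>u. g w * (1 / (u - w))) has_contour_integral g w * 0) (circlepath 0 r)"
        by (rule has_contour_integral_lmul)
      with int have "((\<lambda>u. \<phi> u + g w * (1 / (u - w))) has_contour_integral E + g w * 0) (circlepath 0 r)"
        by (intro has_contour_integral_add) (auto simp: has_contour_integral_integral)
      then have "((\<lambda>u. \<phi> u + g w * (1 / (u - w))) has_contour_integral E) (circlepath 0 r)"
        by simp
      then have "((\<lambda>u. g u / (u - w)) has_contour_integral E) (circlepath 0 r)"
        by (rule has_contour_integral_eq)
           (use r in \<open>auto simp: \<phi>_def diff_divide_distrib\<close>)
      then have "cmod E = cmod (contour_integral (circlepath 0 r) (\<lambda>u. g u / (u - w)))"
        by (simp add: contour_integral_unique)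
      also have "\<dots> \<le> r * integral {0..2*pi} (\<lambda>t. cmod (g (r * cis t) / (r * cis t - w)))"
        using r rR w by (intro norm_contour_integral_circlepath_le continuous_intros gc) auto
      also have "\<dots> \<le> r * integral {0..2*pi} (\<lambda>t. cmod (g (r * cis t)) * (2 / cmod w))"
      proof (intro mult_left_mono integral_le integrable_continuous_real)
        have c: "continuous_on {0..2*pi} (\<lambda>t. g (r * cis t))"
          by (intro continuous_on_compose2[OF gc[OF r(1) rR(2)]] continuous_intros)
             (use r in \<open>auto simp: norm_mult\<close>)
        have nz: "of_real r * cis t - w \<noteq> 0" for t
        proof
          assume "of_real r * cis t - w = 0"
          then have "cmod (of_real r * cis t) = cmod w" by simp
          then show False using r by (simp add: norm_mult)
        qed
        show "continuous_on {0..2*pi} (\<lambda>t. cmod (g (r * cis t) / (r * cis t - w)))"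
          by (intro continuous_intros c) (use nz in auto)
        show "continuous_on {0..2*pi} (\<lambda>t. cmod (g (r * cis t)) * (2 / cmod w))"
          by (intro continuous_intros c) 
        fix t
        have "cmod w / 2 \<le> cmod (of_real r * cis t - w)"
          using norm_triangle_ineq3[of "of_real r * cis t" w] r by (simp add: norm_mult)
        then have "1 / cmod (of_real r * cis t - w) \<le> 2 / cmod w"
          using frac_le[of 1 1 "cmod w / 2" "cmod (of_real r * cis t - w)"] w by simp
        from mult_left_mono[OF this, of "cmod (g (r * cis t))"]
        show "cmod (g (r * cis t) / (r * cis t - w)) \<le> cmod (g (r * cis t)) * (2 / cmod w)"
          by (simp add: norm_divide)
      qed (use r in auto)
      also have "\<dots> \<le> r * (K * (2 / cmod w))"
        using bound[OF r(1) rR(2)] r w by (subst integral_mult_left) (intro mult_left_mono mult_right_mono, auto)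
      finally show ?thesis by (simp add: mult_ac)
    qed
    have "((\<lambda>r. 2 * K / cmod w * r) \<longlongrightarrow> 2 * K / cmod w * 0) (at_right 0)"
      by (intro tendsto_intros)
    moreover have "\<forall>\<^sub>F r in at_right 0. cmod E \<le> 2 * K / cmod w * r"
      unfolding eventually_at_right_field using w E_small
      by (intro exI[of _ "cmod w / 2"]) auto
    ultimately have "cmod E \<le> 2 * K / cmod w * 0"
      by (intro tendsto_lowerbound) auto
    then have "E = 0" by simp
    have "\<phi> contour_integrable_on circlepath 0 R"
      by (rule contour_integral_circlepath_eq(2)[OF open_ball hol\<phi>, of R R]) (auto simp: R_def)
    then have "(\<phi> has_contour_integral 0) (circlepath 0 R)"
      using \<open>E = 0\<close> has_contour_integral_integral unfolding E_def by metis
    moreover have "((\<lambda>u. g w / (u - w)) has_contour_integral 2 * of_real pi * \<i> * g w) (circlepath 0 R)"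
      by (rule Cauchy_integral_circlepath_simple) (use w in auto)
    ultimately have "((\<lambda>u. \<phi> u + g w / (u - w)) has_contour_integral 0 + 2 * of_real pi * \<i> * g w) (circlepath 0 R)"
      by (rule has_contour_integral_add)
    then have "((\<lambda>u. \<phi> u + g w / (u - w)) has_contour_integral 2 * of_real pi * \<i> * g w) (circlepath 0 R)"
      by simp
    then show ?thesis
      by (rule has_contour_integral_eq)
         (use w in \<open>auto simp: \<phi>_def diff_divide_distrib R_def\<close>)
  qed
  define G where "G w = contour_integral (circlepath 0 R) (\<lambda>u. g u / (u - w))" for w
  have intG: "((\<lambda>u. g u / (u - w) ^ 1) has_contour_integral G w) (circlepath 0 R)" if "w \<in> ball 0 R" for w
    unfolding G_def power_one_right
    by (intro has_contour_integral_integral contour_integrable_continuous_circlepath continuous_intros)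
       (use that in \<open>auto simp: R_def intro!: continuous_on_subset[OF gc[of R]]\<close>)
  have holG: "G holomorphic_on ball 0 R"
    unfolding holomorphic_on_open[OF open_ball]
  proof
    fix w :: complex assume w: "w \<in> ball 0 R"
    show "\<exists>f'. (G has_field_derivative f') (at w)"
      using Cauchy_next_derivative_circlepath(2)[OF _ intG _ w] gc[of R] by (auto simp: R_def)
  qed
  define h where "h w = (if w = 0 then G 0 / (2 * of_real pi * \<i>) else g w)" for w
  have hG: "h w = G w / (2 * of_real pi * \<i>)" if "w \<in> ball 0 R" for w
    using that contour_integral_unique[OF cauchy[of w]] by (auto simp: h_def G_def)
  have "h holomorphic_on ball 0 R"
    by (rule holomorphic_transform[of "\<lambda>w. G w / (2 * of_real pi * \<i>)"])
       (use hG in \<open>auto intro!: holomorphic_intros holG\<close>)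
  moreover have "h holomorphic_on ball 0 1 - {0}"
    by (rule holomorphic_transform[OF hol]) (auto simp: h_def)
  ultimately have "h holomorphic_on ball 0 R \<union> (ball 0 1 - {0})"
    by (intro holomorphic_on_Un) auto
  then have "h holomorphic_on ball 0 1"
    by (rule holomorphic_on_subset) (auto simp: R_def)
  then show ?thesis
    by (rule that) (auto simp: h_def)
qed

text \<open>The Taylor coefficients of \<open>f\<close> in the variable \<open>z\<close>, on the disc \<open>\<bar>z\<bar> < \<bar>w\<bar>\<close> over \<open>w\<close>. In the
  variable \<open>\<zeta> = z / w\<close> the coefficient of \<open>\<zeta>^i\<close> in \<open>w f\<close> is \<open>w ^ Suc i * zcoeff f i w\<close>.\<close>

definition zcoeff :: "(complex \<times> complex \<Rightarrow> complex) \<Rightarrow> nat \<Rightarrow> complex \<Rightarrow> complex"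
  where "zcoeff f i w = (deriv ^^ i) (\<lambda>z. f (z, w)) 0 / fact i"

lemma hartogs_slice_holomorphic:
  assumes "holomorphic2_on f hartogs_triangle" "cmod w < 1"
  shows "(\<lambda>z. f (z, w)) holomorphic_on ball 0 (cmod w)"
  by (rule holomorphic2_on_fst[OF assms(1)]) (use assms in \<open>auto simp: hartogs_triangle_def\<close>)

lemma zcoeff_contour_integral:
  assumes f: "holomorphic2_on f hartogs_triangle" and \<rho>: "0 < \<rho>" "\<rho> < cmod w" "cmod w < 1"
  shows "((\<lambda>z. f (z, w) / z ^ Suc i) has_contour_integral 2 * of_real pi * \<i> * zcoeff f i w) (circlepath 0 \<rho>)"
proof -
  have hol: "(\<lambda>z. f (z, w)) holomorphic_on ball 0 (cmod w)"
    using hartogs_slice_holomorphic[OF f \<rho>(3)] .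
  have sub: "cball (0::complex) \<rho> \<subseteq> ball 0 (cmod w)" "ball (0::complex) \<rho> \<subseteq> ball 0 (cmod w)"
    using \<rho> by auto
  have "((\<lambda>u. f (u, w) / (u - 0) ^ Suc i) has_contour_integral
      ((2 * pi * \<i>) / fact i * (deriv ^^ i) (\<lambda>z. f (z, w)) 0)) (circlepath 0 \<rho>)"
    using \<rho> by (intro Cauchy_has_contour_integral_higher_derivative_circlepath
        holomorphic_on_imp_continuous_on holomorphic_on_subset[OF hol] sub) auto
  then show ?thesis
    by (simp add: zcoeff_def)
qed

lemma zcoeff_continuous_on:
  assumes f: "holomorphic2_on f hartogs_triangle" and \<rho>: "0 < \<rho>"
  shows "continuous_on {w. \<rho> < cmod w \<and> cmod w < 1} (zcoeff f i)"
proof -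
  have fc: "continuous_on hartogs_triangle f"
    using holomorphic2_on_imp_continuous_on[OF f] .
  let ?W = "{w. \<rho> < cmod w \<and> cmod w < 1}"
  have "continuous_on ?W (\<lambda>w. integral (cbox 0 (2*pi))
      (\<lambda>t. f (of_real \<rho> * cis t, w) / (of_real \<rho> * cis t) ^ Suc i * \<rho> * \<i> * cis t))"
  proof (rule integral_continuous_on_param, unfold case_prod_unfold)
    show "continuous_on (?W \<times> cbox 0 (2*pi)) (\<lambda>x. f (of_real \<rho> * cis (snd x), fst x)
        / (of_real \<rho> * cis (snd x)) ^ Suc i * \<rho> * \<i> * cis (snd x))"
      by (intro continuous_intros continuous_on_compose2[OF fc])
         (use \<rho> in \<open>auto simp: hartogs_triangle_def norm_mult\<close>)
  qed
  then have "continuous_on ?W (\<lambda>w. integral (cbox 0 (2*pi))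
      (\<lambda>t. f (of_real \<rho> * cis t, w) / (of_real \<rho> * cis t) ^ Suc i * \<rho> * \<i> * cis t) / (2 * of_real pi * \<i>))"
    by (intro continuous_intros) auto
  moreover have "integral (cbox 0 (2*pi))
      (\<lambda>t. f (of_real \<rho> * cis t, w) / (of_real \<rho> * cis t) ^ Suc i * \<rho> * \<i> * cis t) / (2 * of_real pi * \<i>)
      = zcoeff f i w" if "w \<in> ?W" for w
    using contour_integral_unique[OF zcoeff_contour_integral[OF f \<rho>, of w i]] that
    by (simp add: contour_integral_circlepath_cis)
  ultimately show ?thesis
    by (rule continuous_on_eq)
qed

text \<open>Near a given point the coefficient is an integral of \<open>f\<close> over a fixed circle in \<open>z\<close>. Inserting
  Cauchy's formula for \<open>f\<close> in the variable \<open>w\<close> and exchanging the two integrals shows that the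
  coefficient is a Cauchy integral of its own boundary values.\<close>

lemma zcoeff_holomorphic:
  assumes f: "holomorphic2_on f hartogs_triangle"
  shows "zcoeff f i holomorphic_on ball 0 1 - {0}"
  unfolding holomorphic_on_open[OF open_delete[OF open_ball]]
proof
  fix w0 :: complex assume w0: "w0 \<in> ball 0 1 - {0}"
  \<comment> \<open>With these radii \<open>\<bar>z\<bar> = \<rho>\<close> and \<open>\<bar>w - w0\<bar> \<le> \<delta>\<close> imply \<open>\<bar>z\<bar> < \<bar>w\<bar> < 1\<close>.\<close>
  define \<delta> where "\<delta> = min (cmod w0 / 4) ((1 - cmod w0) / 2)"
  define \<rho> where "\<rho> = cmod w0 / 2"
  have \<delta>: "0 < \<delta>" "0 < \<rho>" using w0 by (auto simp: \<delta>_def \<rho>_def)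
  have near: "\<rho> < cmod w" "cmod w < 1" if "w \<in> cball w0 \<delta>" for w
  proof -
    have "cmod w0 - cmod w \<le> \<delta>" "cmod w - cmod w0 \<le> \<delta>"
      using that norm_triangle_ineq2[of w0 w] norm_triangle_ineq2[of w w0]
      by (auto simp: dist_norm norm_minus_commute)
    moreover have "0 < cmod w0" "cmod w0 < 1" using w0 by simp_all
    moreover have "\<delta> \<le> cmod w0 / 4" "\<delta> \<le> (1 - cmod w0) / 2"
      unfolding \<delta>_def by (rule min.cobounded1, rule min.cobounded2)
    ultimately have "cmod w0 / 2 < cmod w \<and> cmod w < 1"
      by argo
    then show "\<rho> < cmod w" "cmod w < 1"
      by (simp_all add: \<rho>_def)
  qed
  have fc: "continuous_on hartogs_triangle f"
    using holomorphic2_on_imp_continuous_on[OF f] .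
  have zc: "contour_integral (circlepath 0 \<rho>) (\<lambda>z. f (z, w) / z ^ Suc i) = 2 * of_real pi * \<i> * zcoeff f i w"
    if "w \<in> cball w0 \<delta>" for w
    using contour_integral_unique[OF zcoeff_contour_integral[OF f \<delta>(2) near[OF that]]] .
  have cont: "continuous_on (path_image (circlepath w0 \<delta>)) (zcoeff f i)"
    by (rule continuous_on_subset[OF zcoeff_continuous_on[OF f \<delta>(2)]]) (use near \<delta> in auto)
  have "((\<lambda>u. zcoeff f i u / (u - w) ^ 1) has_contour_integral 2 * of_real pi * \<i> * zcoeff f i w) (circlepath w0 \<delta>)"
    if w: "w \<in> ball w0 \<delta>" for w
  proof -
    have slice: "contour_integral (circlepath w0 \<delta>) (\<lambda>u. f (z, u) / z ^ Suc i / (u - w))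
        = 2 * of_real pi * \<i> * (f (z, w) / z ^ Suc i)" if z: "z \<in> path_image (circlepath 0 \<rho>)" for z
    proof -
      have zu: "(z, u) \<in> hartogs_triangle" if "u \<in> cball w0 \<delta>" for u
        using near[OF that] z \<delta> by (auto simp: hartogs_triangle_def)
      have "(\<lambda>u. f (z, u) / z ^ Suc i) holomorphic_on cball w0 \<delta>"
        using z \<delta> by (intro holomorphic_intros holomorphic2_on_snd[OF f]) (use zu in auto)
      then show ?thesis
        using w by (intro contour_integral_unique Cauchy_integral_circlepath_simple)
          (auto simp: dist_norm norm_minus_commute)
    qed
    have "2 * of_real pi * \<i> * (2 * of_real pi * \<i> * zcoeff f i w)
        = 2 * of_real pi * \<i> * contour_integral (circlepath 0 \<rho>) (\<lambda>z. f (z, w) / z ^ Suc i)"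
      using zc[of w] w by simp
    also have "\<dots> = contour_integral (circlepath 0 \<rho>) (\<lambda>z. 2 * of_real pi * \<i> * (f (z, w) / z ^ Suc i))"
      by (rule contour_integral_lmul[symmetric])
         (use zcoeff_contour_integral[OF f \<delta>(2) near, of w i] w in \<open>auto simp: contour_integrable_on_def\<close>)
    also have "\<dots> = contour_integral (circlepath 0 \<rho>)
        (\<lambda>z. contour_integral (circlepath w0 \<delta>) (\<lambda>u. f (z, u) / z ^ Suc i / (u - w)))"
      by (rule contour_integral_eq) (simp only: slice)
    also have "\<dots> = contour_integral (circlepath w0 \<delta>)
        (\<lambda>u. contour_integral (circlepath 0 \<rho>) (\<lambda>z. f (z, u) / z ^ Suc i / (u - w)))"
    proof (rule contour_integral_swap, unfold case_prod_unfold)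
      show "continuous_on (path_image (circlepath 0 \<rho>) \<times> path_image (circlepath w0 \<delta>))
          (\<lambda>p. f (fst p, snd p) / fst p ^ Suc i / (snd p - w))"
        using \<delta> w near
        by (intro continuous_intros continuous_on_compose2[OF fc])
           (auto simp: hartogs_triangle_def dist_norm)
    qed (auto simp: vector_derivative_circlepath intro!: continuous_intros)
    also have "\<dots> = contour_integral (circlepath w0 \<delta>)
        (\<lambda>u. 2 * of_real pi * \<i> * (zcoeff f i u / (u - w)))"
    proof (rule contour_integral_eq)
      fix u assume "u \<in> path_image (circlepath w0 \<delta>)"
      then have u: "u \<in> cball w0 \<delta>" using \<delta> by auto
      have "contour_integral (circlepath 0 \<rho>) (\<lambda>z. f (z, u) / z ^ Suc i / (u - w))
          = contour_integral (circlepath 0 \<rho>) (\<lambda>z. f (z, u) / z ^ Suc i) / (u - w)"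
        by (rule contour_integral_div)
           (use zcoeff_contour_integral[OF f \<delta>(2) near[OF u], of i] in \<open>auto simp: contour_integrable_on_def\<close>)
      then show "contour_integral (circlepath 0 \<rho>) (\<lambda>z. f (z, u) / z ^ Suc i / (u - w))
          = 2 * of_real pi * \<i> * (zcoeff f i u / (u - w))"
        using zc[OF u] by simp
    qed
    also have "\<dots> = 2 * of_real pi * \<i> * contour_integral (circlepath w0 \<delta>) (\<lambda>u. zcoeff f i u / (u - w))"
      by (rule contour_integral_lmul)
         (use \<delta> w cont in \<open>auto intro!: contour_integrable_continuous_circlepath continuous_intros simp: dist_norm\<close>)
    finally have "2 * of_real pi * \<i> * zcoeff f i w = contour_integral (circlepath w0 \<delta>) (\<lambda>u. zcoeff f i u / (u - w))"
      by (rule mult_left_cancel[THEN iffD1, rotated]) simp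
    moreover have "(\<lambda>u. zcoeff f i u / (u - w)) contour_integrable_on circlepath w0 \<delta>"
      using \<delta> w cont by (auto intro!: contour_integrable_continuous_circlepath continuous_intros simp: dist_norm)
    ultimately show ?thesis
      by (simp add: has_contour_integral_integral)
  qed
  from Cauchy_next_derivative_circlepath(2)[OF cont this, of w0]
  have "((\<lambda>w. 2 * of_real pi * \<i> * zcoeff f i w) has_field_derivative
      of_nat 1 * contour_integral (circlepath w0 \<delta>) (\<lambda>u. zcoeff f i u / (u - w0) ^ Suc 1)) (at w0)"
    using \<delta> by simp
  from DERIV_cdivide[OF this, of "2 * of_real pi * \<i>"]
  show "\<exists>f'. (zcoeff f i has_field_derivative f') (at w0)"
    by auto
qed

lemma hartogs_slice_series:
  assumes "holomorphic2_on f hartogs_triangle" "cmod \<zeta> < 1" "0 < cmod w" "cmod w < 1"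
  shows "(\<lambda>i. zcoeff f i w * (\<zeta> * w) ^ i) sums f (\<zeta> * w, w)"
  using holomorphic_power_series[OF hartogs_slice_holomorphic[OF assms(1,4)], of "\<zeta> * w"] assms
  by (simp add: zcoeff_def norm_mult)

text \<open>Cauchy's inequality on the circle \<open>\<bar>z\<bar> = s t\<close>, with \<open>B / t\<close> a bound of \<open>f\<close> on the torus with
  radii \<open>s t\<close> and \<open>t\<close>. That one \<open>B\<close> serves every \<open>i\<close> makes the resulting double series summable.\<close>

lemma zcoeff_bound:
  assumes f: "holomorphic2_on f hartogs_triangle" and st: "0 < s" "s < 1" "0 < t" "t < 1"
  shows "\<exists>B\<ge>0. \<forall>i w. cmod w = t \<longrightarrow> cmod (w ^ Suc i * zcoeff f i w) \<le> B / s ^ i"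
proof -
  have "compact (f ` (sphere 0 (s * t) \<times> sphere 0 t))"
    using st by (intro compact_continuous_image compact_Times compact_sphere
        continuous_on_subset[OF holomorphic2_on_imp_continuous_on[OF f]])
       (auto simp: hartogs_triangle_def)
  then obtain B where B: "\<And>z w. cmod z = s * t \<Longrightarrow> cmod w = t \<Longrightarrow> cmod (f (z, w)) \<le> B" "0 < B"
    using compact_imp_bounded[THEN bounded_pos[THEN iffD1]] by fastforce
  have "cmod (w ^ Suc i * zcoeff f i w) \<le> t * B / s ^ i" if w: "cmod w = t" for i w
  proof -
    have "cmod ((deriv ^^ i) (\<lambda>z. f (z, w)) 0) \<le> fact i * B / (s * t) ^ i"
    proof (rule Cauchy_inequality)
      have "s * t < cmod w"
        using st w by simp
      then have sub: "cball (0::complex) (s * t) \<subseteq> ball 0 (cmod w)" "ball (0::complex) (s * t) \<subseteq> ball 0 (cmod w)"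
        by auto
      show "(\<lambda>z. f (z, w)) holomorphic_on ball 0 (s * t)" "continuous_on (cball 0 (s * t)) (\<lambda>z. f (z, w))"
        by (intro holomorphic_on_imp_continuous_on sub
            holomorphic_on_subset[OF hartogs_slice_holomorphic[OF f, of w]]; use st w in simp)+
    qed (use st w B in auto)
    then have "cmod (zcoeff f i w) \<le> B / (s * t) ^ i"
      using divide_right_mono[of _ _ "fact i"] by (fastforce simp: zcoeff_def norm_divide)
    then have "t ^ Suc i * cmod (zcoeff f i w) \<le> t ^ Suc i * (B / (s * t) ^ i)"
      using st by (intro mult_left_mono) auto
    also have "\<dots> = t * B / s ^ i"
      using st by (simp add: power_mult_distrib)
    finally show ?thesis
      using w by (simp add: norm_mult norm_power)
  qed
  then show ?thesis
    using st B by (intro exI[of _ "t * B"]) simp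
qed

text \<open>Cauchy's formula on the circle \<open>\<bar>z\<bar> = t / 2\<close> bounds the coefficient by the mean of \<open>\<bar>f\<bar>\<close>, and
  \<open>x \<le> 1 + x\<^sup>2\<close> replaces this by the square mean that the Hardy norm controls. The radius \<open>t / 2\<close>
  corresponds to \<open>s = 1 / 2\<close>.\<close>

lemma zcoeff_circle_mean_le:
  assumes f: "holomorphic2_on f hartogs_triangle" and t: "0 < t" "t < 1"
  shows "integral {0..2*pi} (\<lambda>\<gamma>. cmod ((of_real t * cis \<gamma>) ^ Suc i * zcoeff f i (of_real t * cis \<gamma>)))
     \<le> 2 ^ i * (2 * pi) * (1 + 2 * hartogs_mean f (1/2) t)"
proof -
  have fc: "continuous_on hartogs_triangle f"
    using holomorphic2_on_imp_continuous_on[OF f] .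
  define F where "F \<theta> \<gamma> = f (of_real (1/2 * t) * cis \<theta>, of_real t * cis \<gamma>)" for \<theta> \<gamma>
  define J where "J \<gamma> = integral {0..2*pi} (\<lambda>\<theta>. (cmod (F \<theta> \<gamma>))\<^sup>2 * (1/2 * t\<^sup>2))" for \<gamma>
  have Fc: "continuous_on A (\<lambda>x. F (snd x) (fst x))" for A
    unfolding F_def using t
    by (intro continuous_on_compose2[OF fc] continuous_intros) (auto simp: hartogs_triangle_def norm_mult)
  have Fc1: "continuous_on A (\<lambda>\<theta>. F \<theta> \<gamma>)" for A \<gamma>
    unfolding F_def using t
    by (intro continuous_on_compose2[OF fc] continuous_intros) (auto simp: hartogs_triangle_def norm_mult)
  have Jc: "continuous_on {0..2*pi} J"
    unfolding J_def box_real[symmetric]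
    by (rule integral_continuous_on_param) (auto simp: case_prod_unfold intro!: continuous_intros Fc)
  have pointwise: "cmod ((of_real t * cis \<gamma>) ^ Suc i * zcoeff f i (of_real t * cis \<gamma>))
      \<le> 2 ^ i / (2 * pi) * (2 * pi + 2 * J \<gamma>)" for \<gamma>
  proof -
    let ?w = "of_real t * cis \<gamma>"
    have "((\<lambda>z. f (z, ?w) / z ^ Suc i) has_contour_integral 2 * of_real pi * \<i> * zcoeff f i ?w) (circlepath 0 (t/2))"
      using t by (intro zcoeff_contour_integral f) (auto simp: norm_mult)
    then have "2 * pi * cmod (zcoeff f i ?w) = cmod (contour_integral (circlepath 0 (t/2)) (\<lambda>z. f (z, ?w) / z ^ Suc i))"
      by (simp add: contour_integral_unique norm_mult)
    also have "\<dots> \<le> t/2 * integral {0..2*pi} (\<lambda>\<theta>. cmod (f (of_real (t/2) * cis \<theta>, ?w) / (of_real (t/2) * cis \<theta>) ^ Suc i))"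
      using t by (intro norm_contour_integral_circlepath_le continuous_intros continuous_on_compose2[OF fc])
        (auto simp: hartogs_triangle_def norm_mult)
    also have "\<dots> = t/2 * integral {0..2*pi} (\<lambda>\<theta>. cmod (F \<theta> \<gamma>) * (1 / (t/2) ^ Suc i))"
      using t by (simp add: F_def norm_divide norm_mult norm_power)
    also have "\<dots> = integral {0..2*pi} (\<lambda>\<theta>. cmod (F \<theta> \<gamma>)) / (t/2) ^ i"
      using t by simp
    finally have "2 * pi * cmod (zcoeff f i ?w) \<le> integral {0..2*pi} (\<lambda>\<theta>. cmod (F \<theta> \<gamma>)) / (t/2) ^ i" .
    then have "t ^ Suc i * (2 * pi * cmod (zcoeff f i ?w))
        \<le> t ^ Suc i * (integral {0..2*pi} (\<lambda>\<theta>. cmod (F \<theta> \<gamma>)) / (t/2) ^ i)"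
      using t by (intro mult_left_mono) auto
    also have "\<dots> = 2 ^ i * (t * integral {0..2*pi} (\<lambda>\<theta>. cmod (F \<theta> \<gamma>)))"
      using t by (simp add: power_divide)
    also have "t * integral {0..2*pi} (\<lambda>\<theta>. cmod (F \<theta> \<gamma>)) = integral {0..2*pi} (\<lambda>\<theta>. t * cmod (F \<theta> \<gamma>))"
      by simp
    also have "\<dots> \<le> integral {0..2*pi} (\<lambda>\<theta>. 1 + 2 * ((cmod (F \<theta> \<gamma>))\<^sup>2 * (1/2 * t\<^sup>2)))"
    proof (intro integral_le integrable_continuous_real continuous_intros Fc1)
      fix \<theta>
      \<comment> \<open>\<open>x \<le> 1 + x\<^sup>2\<close> for \<open>x = t \<bar>F \<theta> \<gamma>\<bar>\<close>\<close>
      have "0 \<le> (t * cmod (F \<theta> \<gamma>) - 1)\<^sup>2 + t * cmod (F \<theta> \<gamma>)"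
        using t by simp
      then show "t * cmod (F \<theta> \<gamma>) \<le> 1 + 2 * ((cmod (F \<theta> \<gamma>))\<^sup>2 * (1/2 * t\<^sup>2))"
        by (simp add: power2_eq_square algebra_simps)
    qed
    also have "\<dots> = 2 * pi + 2 * J \<gamma>"
    proof -
      have "(\<lambda>\<theta>. (cmod (F \<theta> \<gamma>))\<^sup>2 * (1/2 * t\<^sup>2)) integrable_on {0..2*pi}"
        by (intro integrable_continuous_real continuous_intros Fc1)
      then have "integral {0..2*pi} (\<lambda>\<theta>. 1 + 2 * ((cmod (F \<theta> \<gamma>))\<^sup>2 * (1/2 * t\<^sup>2)))
          = integral {0..2*pi} (\<lambda>\<theta>. 1) + integral {0..2*pi} (\<lambda>\<theta>. 2 * ((cmod (F \<theta> \<gamma>))\<^sup>2 * (1/2 * t\<^sup>2)))"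
        by (intro integral_add) (auto intro: integrable_on_cmult_left)
      then show ?thesis
        unfolding J_def by (simp only: integral_mult_right) simp
    qed
    finally have "t ^ Suc i * (2 * pi * cmod (zcoeff f i ?w)) \<le> 2 ^ i * (2 * pi + 2 * J \<gamma>)"
      by (simp add: mult_left_mono)
    then show ?thesis
      using t by (simp add: norm_mult norm_power field_simps)
  qed
  have zc: "continuous_on {0..2*pi} (\<lambda>\<gamma>. zcoeff f i (of_real t * cis \<gamma>))"
    by (intro continuous_on_compose2[OF holomorphic_on_imp_continuous_on[OF zcoeff_holomorphic[OF f]]] continuous_intros)
       (use t in \<open>auto simp: norm_mult\<close>)
  have "integral {0..2*pi} (\<lambda>\<gamma>. cmod ((of_real t * cis \<gamma>) ^ Suc i * zcoeff f i (of_real t * cis \<gamma>)))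
      \<le> integral {0..2*pi} (\<lambda>\<gamma>. 2 ^ i / (2 * pi) * (2 * pi + 2 * J \<gamma>))"
    by (intro integral_le integrable_continuous_real continuous_intros Jc zc pointwise)
  also have "\<dots> = 2 ^ i / (2 * pi) * (integral {0..2*pi} (\<lambda>\<gamma>. 2 * pi) + integral {0..2*pi} (\<lambda>\<gamma>. 2 * J \<gamma>))"
    using Jc by (subst integral_mult_right, subst integral_add)
      (auto intro!: integrable_continuous_real continuous_intros)
  also have "\<dots> = 2 ^ i / (2 * pi) * (4 * pi\<^sup>2 + 2 * (4 * pi\<^sup>2 * hartogs_mean f (1/2) t))"
  proof -
    have "hartogs_mean f (1/2) t = 1 / (4 * pi\<^sup>2) * integral {0..2*pi} J"
      by (simp add: hartogs_mean_def J_def[abs_def] F_def)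
    then show ?thesis
      by (simp add: power2_eq_square)
  qed
  also have "\<dots> = 2 ^ i * (2 * pi) * (1 + 2 * hartogs_mean f (1/2) t)"
    by (simp add: power2_eq_square field_simps)
  finally show ?thesis .
qed

section \<open>Power series expansion of Hardy space functions\<close>

lemma summable_on_geometric_product:
  assumes "0 \<le> x" "x < 1" "0 \<le> y" "y < (1::real)"
  shows "(\<lambda>k. x ^ fst k * y ^ snd k) summable_on (UNIV :: (nat \<times> nat) set)"
proof -
  have g: "((\<lambda>n. z ^ n) has_sum (1 / (1 - z))) UNIV" if "0 \<le> z" "z < 1" for z :: real
    using that geometric_sums[of z] by (intro sums_nonneg_imp_has_sum) auto
  have "(\<lambda>k. x ^ fst k * y ^ snd k) summable_on (UNIV :: nat set) \<times> (UNIV :: nat set)"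
  proof (rule summable_on_SigmaI[where g = "\<lambda>i. x ^ i * (1 / (1 - y))"])
    show "((\<lambda>j. x ^ fst (i, j) * y ^ snd (i, j)) has_sum (x ^ i * (1 / (1 - y)))) UNIV" for i :: nat
      unfolding fst_conv snd_conv using assms by (intro has_sum_cmult_right g)
    show "(\<lambda>i. x ^ i * (1 / (1 - y))) summable_on UNIV"
      using g[OF assms(1,2)] summable_on_cmult_left summable_on_def by blast
  qed (use assms in auto)
  then show ?thesis
    by simp
qed

text \<open>Expand in \<open>z\<close> first. The coefficient functions extend to the whole disc in \<open>w\<close> because their means
  over circles are bounded, so they have Taylor series there. Cauchy's inequalities
  give \<open>\<bar>a (i, j)\<bar> \<le> B / (s^i t^j)\<close> for all \<open>s, t < 1\<close>, which turns the iterated sum into a double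
  sum.\<close>

theorem hartogs_H2_imp_series:
  assumes f: "f \<in> hartogs_H2"
  shows "\<exists>a. hartogs_series f a"
proof -
  have hol: "holomorphic2_on f hartogs_triangle"
    using f by (simp add: hartogs_H2_def)
  obtain M where M: "\<And>s t. 0 < s \<Longrightarrow> s < 1 \<Longrightarrow> 0 < t \<Longrightarrow> t < 1 \<Longrightarrow> hartogs_mean f s t \<le> M"
    using f unfolding hartogs_H2_def bdd_above_def by fastforce
  have "\<exists>h. h holomorphic_on ball 0 1 \<and> (\<forall>w\<in>ball 0 1 - {0}. h w = w ^ Suc i * zcoeff f i w)" for i
  proof -
    have 1: "(\<lambda>w. w ^ Suc i * zcoeff f i w) holomorphic_on ball 0 1 - {0}"
      by (intro holomorphic_intros zcoeff_holomorphic hol)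
    have 2: "integral {0..2*pi} (\<lambda>t. cmod ((of_real r * cis t) ^ Suc i * zcoeff f i (of_real r * cis t)))
        \<le> 2 ^ i * (2 * pi) * (1 + 2 * M)" if "0 < r" "r < 1" for r
      using that M[of "1/2" r]
      by (intro order_trans[OF zcoeff_circle_mean_le[OF hol that]] mult_left_mono) auto
    show ?thesis
      by (rule removable_singularity_bounded_circle_means[OF 1 2]) blast+
  qed
  then obtain h where h: "\<And>i. h i holomorphic_on ball 0 1"
    and h_eq: "\<And>i w. w \<noteq> 0 \<Longrightarrow> cmod w < 1 \<Longrightarrow> h i w = w ^ Suc i * zcoeff f i w"
    by (metis DiffI mem_ball_0 singletonD)
  define a where "a k = (deriv ^^ snd k) (h (fst k)) 0 / fact (snd k)" for k
  have "((\<lambda>k. a k * \<zeta> ^ fst k * w ^ snd k) has_sum (w * f (\<zeta> * w, w))) UNIV"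
    if \<zeta>w: "cmod \<zeta> < 1" "0 < cmod w" "cmod w < 1" for \<zeta> w
  proof -
    \<comment> \<open>Any radii between \<open>\<bar>\<zeta>\<bar>\<close> and 1, and between \<open>\<bar>w\<bar>\<close> and 1, give a convergent geometric majorant.\<close>
    define s where "s = (1 + cmod \<zeta>) / 2"
    define t where "t = (1 + cmod w) / 2"
    have st: "0 < s" "s < 1" "0 < t" "t < 1" and lt: "cmod \<zeta> < s" "cmod w < t"
      using \<zeta>w by (auto simp: s_def t_def add_pos_nonneg)
    obtain B where B: "0 \<le> B" "\<And>i w. cmod w = t \<Longrightarrow> cmod (w ^ Suc i * zcoeff f i w) \<le> B / s ^ i"
      using zcoeff_bound[OF hol st] by blast
    have abound: "cmod (a (i, j)) \<le> B / s ^ i / t ^ j" for i j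
    proof -
      have "cmod ((deriv ^^ j) (h i) 0) \<le> fact j * (B / s ^ i) / t ^ j"
      proof (rule Cauchy_inequality)
        have sub: "cball (0::complex) t \<subseteq> ball 0 1" "ball (0::complex) t \<subseteq> ball 0 1"
          using st by auto
        show "h i holomorphic_on ball 0 t" "continuous_on (cball 0 t) (h i)"
          using holomorphic_on_subset[OF h[of i] sub(2)]
            holomorphic_on_imp_continuous_on[OF holomorphic_on_subset[OF h[of i] sub(1)]] by auto
        show "cmod (h i x) \<le> B / s ^ i" if "cmod (0 - x) = t" for x
          using B(2)[of x i] h_eq[of x i] that st by fastforce
      qed (use st in auto)
      from divide_right_mono[OF this, of "fact j"] show ?thesis
        by (simp add: a_def norm_divide)
    qed
    have "(\<lambda>k. B * ((cmod \<zeta> / s) ^ fst k * (cmod w / t) ^ snd k)) summable_on UNIV"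
      by (intro summable_on_cmult_right summable_on_geometric_product) (use st lt in auto)
    then have "(\<lambda>k. cmod (a k * \<zeta> ^ fst k * w ^ snd k)) summable_on UNIV"
    proof (rule Infinite_Sum.abs_summable_on_comparison_test')
      fix k :: "nat \<times> nat"
      have "cmod (a k * \<zeta> ^ fst k * w ^ snd k) = cmod (a (fst k, snd k)) * (cmod \<zeta> ^ fst k * cmod w ^ snd k)"
        by (simp add: norm_mult norm_power)
      also have "\<dots> \<le> B / s ^ fst k / t ^ snd k * (cmod \<zeta> ^ fst k * cmod w ^ snd k)"
        by (intro mult_right_mono abound) auto
      finally show "cmod (a k * \<zeta> ^ fst k * w ^ snd k) \<le> B * ((cmod \<zeta> / s) ^ fst k * (cmod w / t) ^ snd k)"
        by (simp add: power_divide)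
    qed
    then have summable: "(\<lambda>k. a k * \<zeta> ^ fst k * w ^ snd k) summable_on UNIV"
      by (rule abs_summable_summable)
    then obtain S where S: "((\<lambda>k. a k * \<zeta> ^ fst k * w ^ snd k) has_sum S) UNIV"
      by (auto simp: summable_on_def)
    have inner: "((\<lambda>j. a (i, j) * \<zeta> ^ i * w ^ j) has_sum (\<zeta> ^ i * h i w)) UNIV" for i
    proof -
      have "(\<lambda>j. a (i, j) * w ^ j) sums h i w"
        using holomorphic_power_series[OF h[of i], of w] \<zeta>w by (simp add: a_def)
      then have "(\<lambda>j. \<zeta> ^ i * (a (i, j) * w ^ j)) sums (\<zeta> ^ i * h i w)"
        by (rule sums_mult)
      moreover have "(\<lambda>j. a (i, j) * \<zeta> ^ i * w ^ j) summable_on UNIV"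
        using summable_on_SigmaD1[of "\<lambda>i j. a (i, j) * \<zeta> ^ i * w ^ j" UNIV "\<lambda>_. UNIV"] summable
        by (simp add: case_prod_unfold)
      then obtain T where "((\<lambda>j. a (i, j) * \<zeta> ^ i * w ^ j) has_sum T) UNIV"
        by (auto simp: summable_on_def)
      moreover from this have "(\<lambda>j. a (i, j) * \<zeta> ^ i * w ^ j) sums T"
        by (rule has_sum_imp_sums)
      ultimately show ?thesis
        using sums_unique2 by (fastforce simp: mult_ac)
    qed
    have "((\<lambda>i. \<zeta> ^ i * h i w) has_sum S) UNIV"
      by (rule has_sum_SigmaD[where f = "\<lambda>k. a k * \<zeta> ^ fst k * w ^ snd k" and B = "\<lambda>_. UNIV"])
         (use S inner in auto)
    then have "(\<lambda>i. \<zeta> ^ i * h i w) sums S"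
      by (rule has_sum_imp_sums)
    moreover have "(\<lambda>i. \<zeta> ^ i * h i w) sums (w * f (\<zeta> * w, w))"
    proof -
      have "(\<lambda>i. w * (zcoeff f i w * (\<zeta> * w) ^ i)) sums (w * f (\<zeta> * w, w))"
        by (intro sums_mult hartogs_slice_series hol \<zeta>w)
      moreover have "w * (zcoeff f i w * (\<zeta> * w) ^ i) = \<zeta> ^ i * h i w" for i
        using h_eq[of w i] \<zeta>w by (simp add: power_mult_distrib)
      ultimately show ?thesis by simp
    qed
    ultimately show ?thesis
      using S sums_unique2 by blast
  qed
  then show ?thesis
    unfolding hartogs_series_def by blast
qed

section \<open>Square summable families\<close>

definition square_summable :: "('k \<Rightarrow> complex) \<Rightarrow> bool"
  where "square_summable a \<longleftrightarrow> (\<lambda>k. (cmod (a k))\<^sup>2) summable_on UNIV"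

definition l2_norm :: "('k \<Rightarrow> complex) \<Rightarrow> real"
  where "l2_norm a = sqrt (\<Sum>\<^sub>\<infinity>k. (cmod (a k))\<^sup>2)"

lemma l2_norm_nonneg [simp]: "0 \<le> l2_norm a"
  by (simp add: l2_norm_def infsum_nonneg)

lemma l2_norm_has_sum:
  assumes "square_summable a"
  shows "((\<lambda>k. (cmod (a k))\<^sup>2) has_sum (l2_norm a)\<^sup>2) UNIV"
  using assms by (simp add: l2_norm_def square_summable_def infsum_nonneg)

lemma L2_set_le_l2_norm:
  assumes "square_summable a" "finite F"
  shows "L2_set (\<lambda>k. cmod (a k)) F \<le> l2_norm a"
  unfolding L2_set_def
  by (rule real_le_lsqrt) (use finite_sum_le_has_sum[OF l2_norm_has_sum[OF assms(1)] assms(2)] in \<open>auto simp: sum_nonneg\<close>)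

text \<open>Bounds on finite subfamilies pass to the whole family. Minkowski's inequality and
  completeness reduce in this way to finite sums.\<close>

lemma square_summable_if_L2_set_le:
  assumes "\<And>F. finite F \<Longrightarrow> L2_set (\<lambda>k. cmod (a k)) F \<le> C"
  shows "square_summable a" and "l2_norm a \<le> C"
proof -
  have C: "0 \<le> C" using assms[of "{}"] by simp
  have fin: "(\<Sum>k\<in>F. (cmod (a k))\<^sup>2) \<le> C\<^sup>2" if "finite F" for F
  proof -
    have "(\<Sum>k\<in>F. (cmod (a k))\<^sup>2) = (L2_set (\<lambda>k. cmod (a k)) F)\<^sup>2"
      by (simp add: L2_set_def sum_nonneg)
    then show ?thesis using assms[OF that] by (simp add: power_mono)
  qed
  show ss: "square_summable a"
    unfolding square_summable_def
    by (rule nonneg_bounded_partial_sums_imp_summable_on[where C = "C\<^sup>2"])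
       (auto intro!: eventually_finite_subsets_at_top_weakI fin)
  have "(l2_norm a)\<^sup>2 \<le> C\<^sup>2"
    by (rule has_sum_le_finite_sums[OF l2_norm_has_sum[OF ss]]) (rule fin)
  then show "l2_norm a \<le> C"
    using C by (rule power2_le_imp_le)
qed

lemma l2_norm_triangle:
  assumes "square_summable a" "square_summable b"
  shows "square_summable (\<lambda>k. a k + b k)" and "l2_norm (\<lambda>k. a k + b k) \<le> l2_norm a + l2_norm b"
proof -
  have "L2_set (\<lambda>k. cmod (a k + b k)) F \<le> l2_norm a + l2_norm b" if "finite F" for F
  proof -
    have "L2_set (\<lambda>k. cmod (a k + b k)) F \<le> L2_set (\<lambda>k. cmod (a k) + cmod (b k)) F"
      by (intro L2_set_mono) (auto intro: norm_triangle_ineq)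
    also have "\<dots> \<le> L2_set (\<lambda>k. cmod (a k)) F + L2_set (\<lambda>k. cmod (b k)) F"
      by (rule L2_set_triangle_ineq)
    also have "\<dots> \<le> l2_norm a + l2_norm b"
      by (intro add_mono L2_set_le_l2_norm assms that)
    finally show ?thesis .
  qed
  from square_summable_if_L2_set_le[OF this]
  show "square_summable (\<lambda>k. a k + b k)" "l2_norm (\<lambda>k. a k + b k) \<le> l2_norm a + l2_norm b"
    by simp_all
qed

lemma square_summable_cmult:
  assumes "square_summable a"
  shows "square_summable (\<lambda>k. c * a k)"
  using assms unfolding square_summable_def
  by (auto simp: norm_mult power_mult_distrib intro: summable_on_cmult_right)

lemma square_summable_diff:
  assumes "square_summable a" "square_summable b"
  shows "square_summable (\<lambda>k. a k - b k)"
  using l2_norm_triangle(1)[OF assms(1) square_summable_cmult[OF assms(2), of "-1"]] by simp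

text \<open>The limit is taken coordinatewise. For finitely many coordinates the distance
  of \<open>a n\<close> to it is a limit of the distances of \<open>a n\<close> to \<open>a m\<close> as \<open>m\<close> grows, and the bound does not depend on the choice of the coordinates.\<close>

lemma l2_complete:
  assumes a: "\<And>n::nat. square_summable (a n)"
    and cauchy: "\<And>\<epsilon>. \<epsilon> > 0 \<Longrightarrow> \<exists>N. \<forall>m\<ge>N. \<forall>n\<ge>N. l2_norm (\<lambda>k. a m k - a n k) \<le> \<epsilon>"
  obtains b where "square_summable b" "(\<lambda>n. l2_norm (\<lambda>k. a n k - b k)) \<longlonglongrightarrow> 0"
proof -
  have le: "cmod (a m k - a n k) \<le> l2_norm (\<lambda>k. a m k - a n k)" for m n k
    using L2_set_le_l2_norm[OF square_summable_diff[OF a[of m] a[of n]], of "{k}"] by (simp add: L2_set_def)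
  have "convergent (\<lambda>n. a n k)" for k
  proof (rule Cauchy_convergent, rule metric_CauchyI)
    fix e :: real assume "e > 0"
    then obtain N where N: "\<forall>m\<ge>N. \<forall>n\<ge>N. l2_norm (\<lambda>k. a m k - a n k) \<le> e / 2"
      using cauchy[of "e / 2"] by auto
    have "dist (a m k) (a n k) < e" if "m \<ge> N" "n \<ge> N" for m n
      using le[of m k n] N that \<open>e > 0\<close> by (fastforce simp: dist_norm)
    then show "\<exists>M. \<forall>m\<ge>M. \<forall>n\<ge>M. dist (a m k) (a n k) < e" by blast
  qed
  then obtain b where b: "\<And>k. (\<lambda>n. a n k) \<longlonglongrightarrow> b k"
    unfolding convergent_def by metis
  have near: "square_summable (\<lambda>k. a n k - b k) \<and> l2_norm (\<lambda>k. a n k - b k) \<le> \<epsilon>"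
    if N: "\<forall>m\<ge>N. \<forall>n\<ge>N. l2_norm (\<lambda>k. a m k - a n k) \<le> \<epsilon>" "n \<ge> N" for \<epsilon> N n
  proof -
    have "L2_set (\<lambda>k. cmod (a n k - b k)) F \<le> \<epsilon>" if F: "finite F" for F
    proof (rule tendsto_upperbound)
      show "(\<lambda>m. L2_set (\<lambda>k. cmod (a n k - a m k)) F) \<longlonglongrightarrow> L2_set (\<lambda>k. cmod (a n k - b k)) F"
        unfolding L2_set_def by (intro tendsto_intros b)
      show "\<forall>\<^sub>F m in sequentially. L2_set (\<lambda>k. cmod (a n k - a m k)) F \<le> \<epsilon>"
      proof (rule eventually_sequentiallyI)
        fix m assume "N \<le> m"
        then show "L2_set (\<lambda>k. cmod (a n k - a m k)) F \<le> \<epsilon>"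
          using N F by (intro order_trans[OF L2_set_le_l2_norm[OF square_summable_diff[OF a a]]]) auto
      qed
    qed simp
    from square_summable_if_L2_set_le[OF this] show ?thesis by blast
  qed
  obtain N where N: "\<forall>m\<ge>N. \<forall>n\<ge>N. l2_norm (\<lambda>k. a m k - a n k) \<le> 1"
    using cauchy[of 1] by auto
  have "square_summable (\<lambda>k. a N k - (a N k - b k))"
    by (intro square_summable_diff a near[OF N order_refl, THEN conjunct1])
  then have "square_summable b" by simp
  moreover have "(\<lambda>n. l2_norm (\<lambda>k. a n k - b k)) \<longlonglongrightarrow> 0"
  proof (rule LIMSEQ_I)
    fix r :: real assume r: "0 < r"
    then obtain N where "\<forall>m\<ge>N. \<forall>n\<ge>N. l2_norm (\<lambda>k. a m k - a n k) \<le> r / 2"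
      using cauchy[of "r / 2"] by auto
    then show "\<exists>no. \<forall>n\<ge>no. norm (l2_norm (\<lambda>k. a n k - b k) - 0) < r"
      using near[of N "r / 2"] r by (intro exI[of _ N]) fastforce
  qed
  ultimately show ?thesis by (rule that)
qed

section \<open>The Hardy space as a space of square summable coefficients\<close>

lemma hartogs_series_add:
  assumes "hartogs_series f a" "hartogs_series g b"
  shows "hartogs_series (\<lambda>p. f p + g p) (\<lambda>k. a k + b k)"
  unfolding hartogs_series_def
proof (intro allI impI)
  fix \<zeta> w :: complex assume *: "cmod \<zeta> < 1" "0 < cmod w" "cmod w < 1"
  have "((\<lambda>k. a k * \<zeta> ^ fst k * w ^ snd k + b k * \<zeta> ^ fst k * w ^ snd k) has_sum
      (w * f (\<zeta> * w, w) + w * g (\<zeta> * w, w))) UNIV"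
    using assms * unfolding hartogs_series_def by (intro has_sum_add) blast+
  then show "((\<lambda>k. (a k + b k) * \<zeta> ^ fst k * w ^ snd k) has_sum (w * (f (\<zeta> * w, w) + g (\<zeta> * w, w)))) UNIV"
    by (simp add: algebra_simps)
qed

lemma hartogs_series_cmult:
  assumes "hartogs_series f a"
  shows "hartogs_series (\<lambda>p. c * f p) (\<lambda>k. c * a k)"
  unfolding hartogs_series_def
proof (intro allI impI)
  fix \<zeta> w :: complex assume *: "cmod \<zeta> < 1" "0 < cmod w" "cmod w < 1"
  have "((\<lambda>k. c * (a k * \<zeta> ^ fst k * w ^ snd k)) has_sum (c * (w * f (\<zeta> * w, w)))) UNIV"
    using assms * unfolding hartogs_series_def by (intro has_sum_cmult_right) blast
  then show "((\<lambda>k. c * a k * \<zeta> ^ fst k * w ^ snd k) has_sum (w * (c * f (\<zeta> * w, w)))) UNIV"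
    by (simp add: mult_ac)
qed

lemma hartogs_series_continuous_on:
  "hartogs_series f a \<Longrightarrow> continuous_on hartogs_triangle f"
  by (intro holomorphic2_on_imp_continuous_on hartogs_series_imp_holomorphic2)

lemma hartogs_series_partial_sum_le_mean:
  assumes "hartogs_series f a" "0 < s" "s < 1" "0 < t" "t < 1" "finite F"
  shows "(\<Sum>k\<in>F. (cmod (a k))\<^sup>2 * (s ^ (2 * fst k + 1) * t ^ (2 * snd k))) \<le> hartogs_mean f s t"
  by (rule finite_sum_le_has_sum[OF hartogs_mean_has_sum[OF assms(1) hartogs_series_continuous_on[OF assms(1)] assms(2-5)] assms(6)])
     (use assms in auto)

lemma tendsto_weighted_partial_sum:
  "((\<lambda>r::real. \<Sum>k\<in>F. c k * (r ^ (2 * fst k + 1) * r ^ (2 * snd k))) \<longlongrightarrow> (\<Sum>k\<in>F. c k)) (at_left 1)"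
proof -
  have "((\<lambda>r::real. \<Sum>k\<in>F. c k * (r ^ (2 * fst k + 1) * r ^ (2 * snd k))) \<longlongrightarrow>
      (\<Sum>k\<in>F. c k * (1 ^ (2 * fst k + 1) * 1 ^ (2 * snd k)))) (at_left 1)"
    by (intro tendsto_intros)
  then show ?thesis by simp
qed

lemma eventually_at_left_1_unit: "\<forall>\<^sub>F r::real in at_left 1. 0 < r \<and> r < 1"
  unfolding eventually_at_left_field by (intro exI[of _ 0]) auto

text \<open>A finite part of the sum for the mean at \<open>s = t = r\<close> tends to the corresponding part of
  \<open>\<Sum> \<bar>a k\<bar>\<^sup>2\<close> as \<open>r\<close> tends to 1.\<close>

lemma hartogs_series_square_summable:
  assumes ser: "hartogs_series f a" and M: "\<And>r. 0 < r \<Longrightarrow> r < 1 \<Longrightarrow> hartogs_mean f r r \<le> M"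
  shows "square_summable a"
  unfolding square_summable_def
proof (rule nonneg_bounded_partial_sums_imp_summable_on[where C = M])
  have "(\<Sum>k\<in>F. (cmod (a k))\<^sup>2) \<le> M" if "finite F" for F
  proof (rule tendsto_upperbound[OF tendsto_weighted_partial_sum])
    show "\<forall>\<^sub>F r in at_left 1. (\<Sum>k\<in>F. (cmod (a k))\<^sup>2 * (r ^ (2 * fst k + 1) * r ^ (2 * snd k))) \<le> M"
      using eventually_at_left_1_unit
    proof eventually_elim
      case (elim r)
      then show ?case
        using hartogs_series_partial_sum_le_mean[OF ser, of r r F] M[of r] that by simp
    qed
  qed simp
  then show "\<forall>\<^sub>F F in finite_subsets_at_top UNIV. (\<Sum>k\<in>F. (cmod (a k))\<^sup>2) \<le> M"
    by (intro eventually_finite_subsets_at_top_weakI) auto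
qed auto

lemma hartogs_mean_le_l2_norm:
  assumes "hartogs_series f a" "square_summable a" "0 < s" "s < 1" "0 < t" "t < 1"
  shows "hartogs_mean f s t \<le> (l2_norm a)\<^sup>2"
  by (rule has_sum_mono[OF hartogs_mean_has_sum[OF assms(1) hartogs_series_continuous_on[OF assms(1)] assms(3-6)]
        l2_norm_has_sum[OF assms(2)]])
     (use assms in \<open>auto intro!: mult_left_le mult_le_one power_le_one simp del: power_Suc\<close>)

text \<open>The supremum that defines the Hardy norm is a limit along the diagonal \<open>s = t\<close>, which is
  also the path along which boundary values are taken.\<close>

lemma hartogs_mean_tendsto_l2_norm:
  assumes ser: "hartogs_series f a" and ss: "square_summable a"
  shows "((\<lambda>r. hartogs_mean f r r) \<longlongrightarrow> (l2_norm a)\<^sup>2) (at_left 1)"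
proof (rule order_tendstoI)
  fix c assume "c < (l2_norm a)\<^sup>2"
  then obtain F where F: "finite F" "c < (\<Sum>k\<in>F. (cmod (a k))\<^sup>2)"
    using has_sum_le_finite_sums[OF l2_norm_has_sum[OF ss], of c] by (meson not_le)
  from order_tendstoD(1)[OF tendsto_weighted_partial_sum this(2)] eventually_at_left_1_unit
  show "\<forall>\<^sub>F r in at_left 1. c < hartogs_mean f r r"
  proof eventually_elim
    case (elim r)
    then show ?case
      using hartogs_series_partial_sum_le_mean[OF ser, of r r F] F(1) by simp
  qed
next
  fix c assume c: "(l2_norm a)\<^sup>2 < c"
  show "\<forall>\<^sub>F r in at_left 1. hartogs_mean f r r < c"
    using eventually_at_left_1_unit
  proof eventually_elim
    case (elim r)
    then show ?case
      using hartogs_mean_le_l2_norm[OF ser ss, of r r] c by simp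
  qed
qed

lemma hartogs_norm_eq_l2_norm:
  assumes ser: "hartogs_series f a" and ss: "square_summable a"
  shows "hartogs_norm f = l2_norm a"
proof -
  have "(SUP (s, t)\<in>{0<..<1} \<times> {0<..<1}. hartogs_mean f s t) = (l2_norm a)\<^sup>2"
  proof (rule cSup_eq_non_empty)
    fix y assume y: "\<And>x. x \<in> (\<lambda>(s, t). hartogs_mean f s t) ` ({0<..<1} \<times> {0<..<1}) \<Longrightarrow> x \<le> y"
    show "(l2_norm a)\<^sup>2 \<le> y"
    proof (rule tendsto_upperbound[OF hartogs_mean_tendsto_l2_norm[OF ser ss]])
      show "\<forall>\<^sub>F r in at_left 1. hartogs_mean f r r \<le> y"
        using eventually_at_left_1_unit by eventually_elim (auto intro!: y)
    qed simp
  qed (auto intro!: hartogs_mean_le_l2_norm[OF ser ss])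
  then show ?thesis
    by (simp add: hartogs_norm_def)
qed

lemma hartogs_H2_iff_series:
  "f \<in> hartogs_H2 \<longleftrightarrow>
     (\<forall>p. p \<notin> hartogs_triangle \<longrightarrow> f p = 0) \<and> (\<exists>a. hartogs_series f a \<and> square_summable a)"
proof
  assume f: "f \<in> hartogs_H2"
  then obtain M where "\<And>s t. 0 < s \<Longrightarrow> s < 1 \<Longrightarrow> 0 < t \<Longrightarrow> t < 1 \<Longrightarrow> hartogs_mean f s t \<le> M"
    unfolding hartogs_H2_def bdd_above_def by fastforce
  moreover obtain a where a: "hartogs_series f a"
    using hartogs_H2_imp_series[OF f] by blast
  ultimately have "square_summable a"
    by (intro hartogs_series_square_summable[OF a]) auto
  then show "(\<forall>p. p \<notin> hartogs_triangle \<longrightarrow> f p = 0) \<and> (\<exists>a. hartogs_series f a \<and> square_summable a)"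
    using a f unfolding hartogs_H2_def by blast
next
  assume "(\<forall>p. p \<notin> hartogs_triangle \<longrightarrow> f p = 0) \<and> (\<exists>a. hartogs_series f a \<and> square_summable a)"
  then obtain a where "\<forall>p. p \<notin> hartogs_triangle \<longrightarrow> f p = 0" and a: "hartogs_series f a" "square_summable a"
    by blast
  moreover have "bdd_above ((\<lambda>(s, t). hartogs_mean f s t) ` ({0<..<1} \<times> {0<..<1}))"
    using hartogs_mean_le_l2_norm[OF a] by (intro bdd_aboveI[of _ "(l2_norm a)\<^sup>2"]) auto
  ultimately show "f \<in> hartogs_H2"
    using hartogs_series_imp_holomorphic2 by (auto simp: hartogs_H2_def)
qed

lemma hartogs_H2E:
  assumes "f \<in> hartogs_H2"
  obtains a where "hartogs_series f a" "square_summable a" "hartogs_norm f = l2_norm a"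
  using assms hartogs_H2_iff_series hartogs_norm_eq_l2_norm by metis

lemma hartogs_H2_add:
  assumes "f \<in> hartogs_H2" "g \<in> hartogs_H2"
  shows "(\<lambda>p. f p + g p) \<in> hartogs_H2"
  using assms unfolding hartogs_H2_iff_series
  by (fastforce intro: hartogs_series_add l2_norm_triangle(1))

lemma hartogs_H2_cmult:
  assumes "f \<in> hartogs_H2"
  shows "(\<lambda>p. c * f p) \<in> hartogs_H2"
  using assms unfolding hartogs_H2_iff_series
  by (fastforce intro: hartogs_series_cmult square_summable_cmult)

lemma hartogs_H2_diff:
  assumes "f \<in> hartogs_H2" "g \<in> hartogs_H2"
  shows "(\<lambda>p. f p - g p) \<in> hartogs_H2"
  using hartogs_H2_add[OF assms(1) hartogs_H2_cmult[OF assms(2), of "-1"]] by simp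

lemma hartogs_norm_triangle:
  assumes "f \<in> hartogs_H2" "g \<in> hartogs_H2"
  shows "hartogs_norm (\<lambda>p. f p + g p) \<le> hartogs_norm f + hartogs_norm g"
proof -
  obtain a where a: "hartogs_series f a" "square_summable a" "hartogs_norm f = l2_norm a"
    using hartogs_H2E[OF assms(1)] .
  obtain b where b: "hartogs_series g b" "square_summable b" "hartogs_norm g = l2_norm b"
    using hartogs_H2E[OF assms(2)] .
  show ?thesis
    using hartogs_norm_eq_l2_norm[OF hartogs_series_add[OF a(1) b(1)]] l2_norm_triangle[OF a(2) b(2)] a b
    by simp
qed

lemma hartogs_norm_nonneg: "f \<in> hartogs_H2 \<Longrightarrow> 0 \<le> hartogs_norm f"
  using hartogs_H2E l2_norm_nonneg by metis

lemma hartogs_norm_minus_commute: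
  "hartogs_norm (\<lambda>p. f p - g p) = hartogs_norm (\<lambda>p. g p - f p)"
proof -
  have "hartogs_mean (\<lambda>p. f p - g p) s t = hartogs_mean (\<lambda>p. g p - f p) s t" for s t
    by (simp add: hartogs_mean_def norm_minus_commute)
  then show ?thesis by (simp add: hartogs_norm_def)
qed

text \<open>All coefficients vanish, so the function vanishes on the triangle; off the triangle it is zero by
  convention.\<close>

lemma hartogs_norm_eq_0:
  assumes "f \<in> hartogs_H2" "hartogs_norm f = 0"
  shows "f = (\<lambda>p. 0)"
proof
  fix p
  obtain a where a: "hartogs_series f a" "square_summable a" "hartogs_norm f = l2_norm a"
    using hartogs_H2E[OF assms(1)] .
  have a0: "a k = 0" for k
    using nonneg_has_sum_le_0D[OF l2_norm_has_sum[OF a(2)], of k] a(3) assms(2) by simp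
  show "f p = 0"
  proof (cases "p \<in> hartogs_triangle")
    case True
    define \<zeta> where "\<zeta> = fst p / snd p"
    have p: "snd p \<noteq> 0" "cmod (snd p) < 1" "cmod \<zeta> < 1" "p = (\<zeta> * snd p, snd p)"
      using True by (auto simp: hartogs_triangle_def \<zeta>_def norm_divide divide_simps)
    then have "((\<lambda>k. a k * \<zeta> ^ fst k * snd p ^ snd k) has_sum (snd p * f (\<zeta> * snd p, snd p))) UNIV"
      using a(1)[unfolded hartogs_series_def, rule_format, of \<zeta> "snd p"] by simp
    then have "((\<lambda>k. 0) has_sum (snd p * f p)) (UNIV :: (nat \<times> nat) set)"
      using p(4) by (simp add: a0)
    then show ?thesis
      using p(1) has_sum_unique[OF has_sum_0_simp] by fastforce
  next
    case False
    then show ?thesis using assms(1) unfolding hartogs_H2_def by blast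
  qed
qed

lemma has_sum_finite_sum:
  fixes f :: "'i \<Rightarrow> 'k \<Rightarrow> 'b :: topological_comm_monoid_add"
  assumes "finite I" "\<And>i. i \<in> I \<Longrightarrow> (f i has_sum s i) A"
  shows "((\<lambda>x. \<Sum>i\<in>I. f i x) has_sum (\<Sum>i\<in>I. s i)) A"
  using assms by (induction I rule: finite_induct) (auto intro: has_sum_add)

text \<open>Polarization of \<open>\<parallel>f\<parallel>\<^sup>2 = \<Sum> \<bar>a k\<bar>\<^sup>2\<close>, carried out in each coefficient.\<close>

lemma hartogs_inner_has_sum:
  assumes f: "hartogs_series f a" "square_summable a" and g: "hartogs_series g b" "square_summable b"
  shows "((\<lambda>k. a k * cnj (b k)) has_sum hartogs_inner f g) UNIV"
proof -
  have summand: "((\<lambda>k. \<i> ^ n * of_real ((cmod (a k + \<i> ^ n * b k))\<^sup>2)) has_sum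
      (\<i> ^ n * of_real ((hartogs_norm (\<lambda>p. f p + \<i> ^ n * g p))\<^sup>2))) UNIV" for n
  proof -
    have ser: "hartogs_series (\<lambda>p. f p + \<i> ^ n * g p) (\<lambda>k. a k + \<i> ^ n * b k)"
      by (intro hartogs_series_add hartogs_series_cmult f g)
    have ss: "square_summable (\<lambda>k. a k + \<i> ^ n * b k)"
      by (intro l2_norm_triangle(1) square_summable_cmult f g)
    show ?thesis
      using l2_norm_has_sum[OF ss] hartogs_norm_eq_l2_norm[OF ser ss]
      by (intro has_sum_cmult_right has_sum_of_real) simp
  qed
  have "((\<lambda>k. (1/4) * (\<Sum>n<4. \<i> ^ n * of_real ((cmod (a k + \<i> ^ n * b k))\<^sup>2))) has_sum
      ((1/4) * (\<Sum>n<4. \<i> ^ n * of_real ((hartogs_norm (\<lambda>p. f p + \<i> ^ n * g p))\<^sup>2)))) UNIV"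
    by (intro has_sum_cmult_right has_sum_finite_sum summand finite_lessThan)
  moreover have "(1/4) * (\<Sum>n<4. \<i> ^ n * of_real ((cmod (x + \<i> ^ n * y))\<^sup>2)) = x * cnj y" for x y :: complex
    unfolding complex_norm_square by (simp add: eval_nat_numeral algebra_simps)
  ultimately show ?thesis
    by (simp add: hartogs_inner_def)
qed

section \<open>Multiplication by bounded and by inner functions\<close>

lemma hartogs_mean_mult_le:
  assumes m: "continuous_on hartogs_triangle m" "\<And>p. p \<in> hartogs_triangle \<Longrightarrow> cmod (m p) \<le> C"
    and f: "continuous_on hartogs_triangle f" and st: "0 < s" "s < 1" "0 < t" "t < 1"
  shows "hartogs_mean (\<lambda>p. m p * f p) s t \<le> C\<^sup>2 * hartogs_mean f s t"
proof -
  let ?P = "\<lambda>x. (of_real (s * t) * cis (fst x), of_real t * cis (snd x))"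
  have mf: "continuous_on hartogs_triangle (\<lambda>p. m p * f p)"
    by (intro continuous_intros m f)
  have "integral torus_box (\<lambda>x. (cmod (m (?P x) * f (?P x)))\<^sup>2 * (s * t\<^sup>2))
      \<le> integral torus_box (\<lambda>x. C\<^sup>2 * ((cmod (f (?P x)))\<^sup>2 * (s * t\<^sup>2)))"
  proof (intro integral_le integrable_continuous continuous_intros continuous_on_hartogs_torus m(1) f st)
    fix x
    have "(cmod (m (?P x)))\<^sup>2 \<le> C\<^sup>2"
      by (intro power_mono m(2) hartogs_torus_mem st) auto
    then show "(cmod (m (?P x) * f (?P x)))\<^sup>2 * (s * t\<^sup>2) \<le> C\<^sup>2 * ((cmod (f (?P x)))\<^sup>2 * (s * t\<^sup>2))"
      using st by (simp add: norm_mult power_mult_distrib mult.assoc mult_right_mono)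
  qed
  then show ?thesis
    unfolding hartogs_mean_eq_integral_torus[OF mf st] hartogs_mean_eq_integral_torus[OF f st]
    by (simp add: divide_right_mono)
qed

lemma hartogs_H2_bounded_mult:
  assumes m: "holomorphic2_on m hartogs_triangle" "\<And>p. p \<in> hartogs_triangle \<Longrightarrow> cmod (m p) \<le> C"
    and f: "f \<in> hartogs_H2"
  shows "(\<lambda>p. m p * f p) \<in> hartogs_H2"
    and "hartogs_norm (\<lambda>p. m p * f p) \<le> C * hartogs_norm f"
proof -
  have C: "0 \<le> C"
    using order_trans[OF norm_ge_zero m(2)[OF hartogs_torus_mem[of "1/2" "1/2" 0 0]]] by simp
  have hol: "holomorphic2_on f hartogs_triangle" "\<And>p. p \<notin> hartogs_triangle \<Longrightarrow> f p = 0"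
    using f unfolding hartogs_H2_def by blast+
  obtain a where a: "hartogs_series f a" "square_summable a" "hartogs_norm f = l2_norm a"
    using hartogs_H2E[OF f] .
  have mean: "hartogs_mean (\<lambda>p. m p * f p) s t \<le> (C * hartogs_norm f)\<^sup>2"
    if st: "0 < s" "s < 1" "0 < t" "t < 1" for s t
  proof -
    have "hartogs_mean (\<lambda>p. m p * f p) s t \<le> C\<^sup>2 * hartogs_mean f s t"
      by (intro hartogs_mean_mult_le holomorphic2_on_imp_continuous_on m hol st)
    also have "\<dots> \<le> C\<^sup>2 * (hartogs_norm f)\<^sup>2"
      unfolding a(3) by (intro mult_left_mono hartogs_mean_le_l2_norm[OF a(1,2) st]) auto
    finally show ?thesis by (simp add: power_mult_distrib)
  qed
  have "bdd_above ((\<lambda>(s, t). hartogs_mean (\<lambda>p. m p * f p) s t) ` ({0<..<1} \<times> {0<..<1}))"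
    using mean by (intro bdd_aboveI[of _ "(C * hartogs_norm f)\<^sup>2"]) auto
  then show mf: "(\<lambda>p. m p * f p) \<in> hartogs_H2"
    using holomorphic2_on_mult[OF m(1) hol(1)] hol(2) unfolding hartogs_H2_def by simp
  obtain b where b: "hartogs_series (\<lambda>p. m p * f p) b" "square_summable b"
      "hartogs_norm (\<lambda>p. m p * f p) = l2_norm b"
    using hartogs_H2E[OF mf] .
  have "(l2_norm b)\<^sup>2 \<le> (C * hartogs_norm f)\<^sup>2"
  proof (rule tendsto_upperbound[OF hartogs_mean_tendsto_l2_norm[OF b(1,2)]])
    show "\<forall>\<^sub>F r in at_left 1. hartogs_mean (\<lambda>p. m p * f p) r r \<le> (C * hartogs_norm f)\<^sup>2"
      using eventually_at_left_1_unit by eventually_elim (auto intro!: mean)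
  qed simp
  then have "l2_norm b \<le> C * hartogs_norm f"
    by (rule power2_le_imp_le[OF _ mult_nonneg_nonneg[OF C hartogs_norm_nonneg[OF f]]])
  then show "hartogs_norm (\<lambda>p. m p * f p) \<le> C * hartogs_norm f"
    by (simp only: b(3))
qed

text \<open>The inverse of the passage from a function to its coefficients.\<close>

definition hartogs_function :: "(nat \<times> nat \<Rightarrow> complex) \<Rightarrow> complex \<times> complex \<Rightarrow> complex"
  where "hartogs_function a p = (if p \<in> hartogs_triangle
     then (\<Sum>\<^sub>\<infinity>k. a k * (fst p / snd p) ^ fst k * snd p ^ snd k) / snd p else 0)"

lemma hartogs_function_series:
  assumes "square_summable a"
  shows "hartogs_series (hartogs_function a) a"
  unfolding hartogs_series_def
proof (intro allI impI)
  fix \<zeta> w :: complex assume *: "cmod \<zeta> < 1" "0 < cmod w" "cmod w < 1"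
  have bound: "cmod (a k) \<le> l2_norm a" for k
    using L2_set_le_l2_norm[OF assms, of "{k}"] by (simp add: L2_set_def)
  have "(\<lambda>k. l2_norm a * (cmod \<zeta> ^ fst k * cmod w ^ snd k)) summable_on UNIV"
    by (intro summable_on_cmult_right summable_on_geometric_product) (use * in auto)
  then have "(\<lambda>k. cmod (a k * \<zeta> ^ fst k * w ^ snd k)) summable_on UNIV"
  proof (rule Infinite_Sum.abs_summable_on_comparison_test')
    show "cmod (a k * \<zeta> ^ fst k * w ^ snd k) \<le> l2_norm a * (cmod \<zeta> ^ fst k * cmod w ^ snd k)" for k
      unfolding norm_mult norm_power mult.assoc by (intro mult_right_mono bound) auto
  qed
  then have "((\<lambda>k. a k * \<zeta> ^ fst k * w ^ snd k) has_sum (\<Sum>\<^sub>\<infinity>k. a k * \<zeta> ^ fst k * w ^ snd k)) UNIV"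
    by (rule has_sum_infsum[OF abs_summable_summable])
  then show "((\<lambda>k. a k * \<zeta> ^ fst k * w ^ snd k) has_sum (w * hartogs_function a (\<zeta> * w, w))) UNIV"
    using * hartogs_triangle_polar[OF *] by (simp add: hartogs_function_def)
qed

lemma hartogs_function_in_H2: "square_summable a \<Longrightarrow> hartogs_function a \<in> hartogs_H2"
  using hartogs_function_series unfolding hartogs_H2_iff_series by (auto simp: hartogs_function_def)

lemma hartogs_triangle_polarE:
  assumes "p \<in> hartogs_triangle"
  obtains \<zeta> w where "cmod \<zeta> < 1" "0 < cmod w" "cmod w < 1" "p = (\<zeta> * w, w)"
  using assms by (intro that[of "fst p / snd p" "snd p"])
    (auto simp: hartogs_triangle_def norm_divide divide_simps)

lemma hartogs_function_finite_bounded: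
  assumes F: "finite F" and p: "p \<in> hartogs_triangle"
  shows "cmod (snd p * hartogs_function (\<lambda>k. if k \<in> F then a k else 0) p) \<le> (\<Sum>k\<in>F. cmod (a k))"
proof -
  obtain \<zeta> w where \<zeta>w: "cmod \<zeta> < 1" "0 < cmod w" "cmod w < 1" "p = (\<zeta> * w, w)"
    using hartogs_triangle_polarE[OF p] .
  have "(\<Sum>\<^sub>\<infinity>k. (if k \<in> F then a k else 0) * \<zeta> ^ fst k * w ^ snd k) = (\<Sum>k\<in>F. a k * \<zeta> ^ fst k * w ^ snd k)"
    using F by (subst infsum_cong_neutral[where T = F and g = "\<lambda>k. a k * \<zeta> ^ fst k * w ^ snd k"]) auto
  then have "snd p * hartogs_function (\<lambda>k. if k \<in> F then a k else 0) p = (\<Sum>k\<in>F. a k * \<zeta> ^ fst k * w ^ snd k)"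
    using p \<zeta>w by (simp add: hartogs_function_def)
  also have "cmod \<dots> \<le> (\<Sum>k\<in>F. cmod (a k))"
  proof (rule order_trans[OF norm_sum], rule sum_mono)
    fix k
    have "cmod \<zeta> ^ fst k * cmod w ^ snd k \<le> 1"
      using \<zeta>w by (intro mult_le_one power_le_one) auto
    then show "cmod (a k * \<zeta> ^ fst k * w ^ snd k) \<le> cmod (a k)"
      by (simp add: norm_mult norm_power mult.assoc mult_left_le)
  qed
  finally show ?thesis .
qed

text \<open>The norms are limits of means along \<open>s = t = r\<close>. The difference of the means of \<open>q f\<close> and \<open>f\<close> is
  the integral of \<open>(\<bar>q\<bar>\<^sup>2 - 1) \<bar>f\<bar>\<^sup>2 r\<^sup>3\<close>, where \<open>\<bar>f\<bar>\<^sup>2 r\<^sup>3 \<le> B\<^sup>2\<close> on \<open>\<bar>w\<bar> = r\<close>. Its integrand is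
  bounded and tends to zero wherever \<open>q\<close> has a boundary value of modulus 1.\<close>

lemma hartogs_inner_function_norm_bounded:
  assumes q: "hartogs_inner_function q" and f: "f \<in> hartogs_H2"
    and B: "\<And>p. p \<in> hartogs_triangle \<Longrightarrow> cmod (snd p * f p) \<le> B"
  shows "hartogs_norm (\<lambda>p. q p * f p) = hartogs_norm f"
proof -
  obtain C where C: "\<And>p. p \<in> hartogs_triangle \<Longrightarrow> cmod (q p) \<le> C"
    using q unfolding hartogs_inner_function_def bounded_iff by blast
  have hq: "holomorphic2_on q hartogs_triangle"
    using q by (simp add: hartogs_inner_function_def)
  have hf: "holomorphic2_on f hartogs_triangle"
    using f by (simp add: hartogs_H2_def)
  note qc = holomorphic2_on_imp_continuous_on[OF hq] and fc = holomorphic2_on_imp_continuous_on[OF hf]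
  have qfc: "continuous_on hartogs_triangle (\<lambda>p. q p * f p)"
    by (intro continuous_intros qc fc)
  have qf: "(\<lambda>p. q p * f p) \<in> hartogs_H2"
    by (rule hartogs_H2_bounded_mult(1)[OF hq C f])
  \<comment> \<open>A sequence tending to 1 from below, as dominated convergence is about sequences.\<close>
  define r where "r n = 1 - 1 / (real n + 2)" for n
  have r: "0 < r n" "r n < 1" for n
    by (auto simp: r_def field_simps)
  have "r \<longlonglongrightarrow> 1"
    unfolding r_def by real_asymp
  then have r_lim: "filterlim r (at_left 1) sequentially"
    using r(2) by (auto simp: filterlim_at less_imp_neq[OF r(2)])
  define Q where "Q n x = q (of_real ((r n)\<^sup>2) * cis (fst x), of_real (r n) * cis (snd x))" for n and x :: "real \<times> real"
  define G where "G n x = f (of_real ((r n)\<^sup>2) * cis (fst x), of_real (r n) * cis (snd x))" for n and x :: "real \<times> real"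
  define D where "D n x = ((cmod (Q n x))\<^sup>2 - 1) * ((cmod (G n x))\<^sup>2 * (r n * (r n)\<^sup>2))" for n x
  have mem: "(of_real ((r n)\<^sup>2) * cis \<theta>, of_real (r n) * cis \<gamma>) \<in> hartogs_triangle" for n \<theta> \<gamma>
    using hartogs_torus_mem[OF r r, of n n \<theta> \<gamma>] by (simp add: power2_eq_square)
  have Qc: "continuous_on A (Q n)" and Gc: "continuous_on A (G n)" for A n
    using continuous_on_hartogs_torus[OF qc r r, of A n n] continuous_on_hartogs_torus[OF fc r r, of A n n]
    unfolding Q_def[abs_def] G_def[abs_def] by (simp_all add: power2_eq_square)
  have Dc: "continuous_on A (D n)" for A n
    unfolding D_def by (intro continuous_intros Qc Gc)
  have G_bound: "(cmod (G n x))\<^sup>2 * (r n * (r n)\<^sup>2) \<le> B\<^sup>2" for n x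
  proof -
    have "r n * cmod (G n x) \<le> B"
      using B[OF mem[of n "fst x" "snd x"]] r[of n] by (simp add: G_def norm_mult)
    then have "(r n * cmod (G n x))\<^sup>2 \<le> B\<^sup>2"
      using r[of n] by (intro power_mono) auto
    moreover have "(r n * cmod (G n x))\<^sup>2 * r n \<le> (r n * cmod (G n x))\<^sup>2"
      using r[of n] by (intro mult_left_le) auto
    ultimately show ?thesis
      by (simp add: power_mult_distrib mult_ac)
  qed
  have D_bound: "\<bar>D n x\<bar> \<le> \<bar>(cmod (Q n x))\<^sup>2 - 1\<bar> * B\<^sup>2" for n x
  proof -
    have "0 \<le> (cmod (G n x))\<^sup>2 * (r n * (r n)\<^sup>2)"
      using r[of n] by simp
    then show ?thesis
      unfolding D_def abs_mult using G_bound[of n x] by (intro mult_left_mono) auto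
  qed
  have mean_diff: "hartogs_mean (\<lambda>p. q p * f p) (r n) (r n) - hartogs_mean f (r n) (r n)
      = 1 / (4 * pi\<^sup>2) * integral torus_box (D n)" for n
  proof -
    have "integral torus_box (\<lambda>x. (cmod (Q n x * G n x))\<^sup>2 * (r n * (r n)\<^sup>2))
        - integral torus_box (\<lambda>x. (cmod (G n x))\<^sup>2 * (r n * (r n)\<^sup>2)) = integral torus_box (D n)"
      by (subst integral_diff[symmetric])
         (auto simp: D_def[abs_def] norm_mult algebra_simps intro!: integrable_continuous continuous_intros Qc Gc)
    then show ?thesis
      unfolding hartogs_mean_eq_integral_torus[OF qfc r r] hartogs_mean_eq_integral_torus[OF fc r r]
      by (simp add: Q_def G_def power2_eq_square flip: right_diff_distrib diff_divide_distrib)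
  qed
  have box: "{0..2*pi} \<times> {0..2*pi} = torus_box"
    by (simp add: cbox_Pair_eq)
  have D_int: "integrable (lebesgue_on torus_box) (D n)" for n
    by (rule continuous_imp_integrable[OF Dc])
  have AE: "AE x in lebesgue_on torus_box. (\<lambda>n. D n x) \<longlonglongrightarrow> 0"
  proof -
    have "AE x in lebesgue_on torus_box. \<exists>l. hartogs_boundary_value q (cis (fst x)) (cis (snd x)) l \<and> cmod l = 1"
      using q unfolding hartogs_inner_function_def box by blast
    then show ?thesis
    proof eventually_elim
      case (elim x)
      then obtain l where l: "((\<lambda>\<rho>::real. q (of_real (\<rho>\<^sup>2) * cis (fst x), of_real \<rho> * cis (snd x))) \<longlongrightarrow> l) (at_left 1)"
          "cmod l = 1"
        by (auto simp: hartogs_boundary_value_def)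
      have "(\<lambda>n. Q n x) \<longlonglongrightarrow> l"
        unfolding Q_def by (rule filterlim_compose[OF l(1) r_lim])
      then have "(\<lambda>n. \<bar>(cmod (Q n x))\<^sup>2 - 1\<bar> * B\<^sup>2) \<longlonglongrightarrow> \<bar>(cmod l)\<^sup>2 - 1\<bar> * B\<^sup>2"
        by (intro tendsto_intros)
      then have "(\<lambda>n. \<bar>(cmod (Q n x))\<^sup>2 - 1\<bar> * B\<^sup>2) \<longlonglongrightarrow> 0"
        using l(2) by simp
      then show ?case
        by (rule Lim_null_comparison[rotated]) (use D_bound in \<open>auto intro!: always_eventually\<close>)
    qed
  qed
  have "(\<lambda>n. integral\<^sup>L (lebesgue_on torus_box) (D n)) \<longlonglongrightarrow> integral\<^sup>L (lebesgue_on torus_box) (\<lambda>x. 0)"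
  proof (rule integral_dominated_convergence[where w = "\<lambda>x. (C\<^sup>2 + 1) * B\<^sup>2"])
    show "AE x in lebesgue_on torus_box. norm (D n x) \<le> (C\<^sup>2 + 1) * B\<^sup>2" for n
    proof (rule AE_I2)
      fix x
      have "(cmod (Q n x))\<^sup>2 \<le> C\<^sup>2"
        unfolding Q_def by (intro power_mono C mem) auto
      then have "\<bar>(cmod (Q n x))\<^sup>2 - 1\<bar> \<le> C\<^sup>2 + 1"
        by (simp add: abs_le_iff add_increasing)
      then show "norm (D n x) \<le> (C\<^sup>2 + 1) * B\<^sup>2"
        using order_trans[OF D_bound mult_right_mono] by simp
    qed
    show "integrable (lebesgue_on torus_box) (\<lambda>x. (C\<^sup>2 + 1) * B\<^sup>2)"
      by (rule continuous_imp_integrable) (rule continuous_on_const)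
  qed (use AE D_int in \<open>auto dest: borel_measurable_integrable\<close>)
  then have "(\<lambda>n. integral torus_box (D n)) \<longlonglongrightarrow> 0"
    using D_int by (simp add: lebesgue_integral_eq_integral)
  from tendsto_mult_right_zero[OF this, of "1 / (4 * pi\<^sup>2)"]
  have "(\<lambda>n. hartogs_mean (\<lambda>p. q p * f p) (r n) (r n) - hartogs_mean f (r n) (r n)) \<longlonglongrightarrow> 0"
    by (simp add: mean_diff)
  moreover have "(\<lambda>n. hartogs_mean g (r n) (r n)) \<longlonglongrightarrow> (hartogs_norm g)\<^sup>2" if g: "g \<in> hartogs_H2" for g
  proof -
    obtain a where a: "hartogs_series g a" "square_summable a" "hartogs_norm g = l2_norm a"
      using hartogs_H2E[OF g] .
    show ?thesis
      unfolding a(3) by (rule filterlim_compose[OF hartogs_mean_tendsto_l2_norm[OF a(1,2)] r_lim])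
  qed
  then have "(\<lambda>n. hartogs_mean (\<lambda>p. q p * f p) (r n) (r n) - hartogs_mean f (r n) (r n))
      \<longlonglongrightarrow> (hartogs_norm (\<lambda>p. q p * f p))\<^sup>2 - (hartogs_norm f)\<^sup>2"
    using qf f by (intro tendsto_diff) auto
  ultimately have "(hartogs_norm (\<lambda>p. q p * f p))\<^sup>2 = (hartogs_norm f)\<^sup>2"
    using LIMSEQ_unique by fastforce
  then show ?thesis
    using hartogs_norm_nonneg[OF qf] hartogs_norm_nonneg[OF f] by (rule power2_eq_imp_eq)
qed

text \<open>Finitely many coefficients carry the norm up to \<open>\<epsilon>\<close>, and the function that they define is
  bounded after multiplication by \<open>w\<close>.\<close>

lemma hartogs_H2_approx_bounded:
  assumes f: "f \<in> hartogs_H2" and \<epsilon>: "0 < \<epsilon>"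
  shows "\<exists>g\<in>hartogs_H2. (\<exists>B. \<forall>p\<in>hartogs_triangle. cmod (snd p * g p) \<le> B)
           \<and> hartogs_norm (\<lambda>p. f p - g p) \<le> \<epsilon>"
proof -
  obtain a where a: "hartogs_series f a" "square_summable a"
    using hartogs_H2E[OF f] .
  have "(l2_norm a)\<^sup>2 - \<epsilon>\<^sup>2 < (l2_norm a)\<^sup>2" using \<epsilon> by simp
  then obtain F where F: "finite F" "(l2_norm a)\<^sup>2 - \<epsilon>\<^sup>2 < (\<Sum>k\<in>F. (cmod (a k))\<^sup>2)"
    using has_sum_le_finite_sums[OF l2_norm_has_sum[OF a(2)], of "(l2_norm a)\<^sup>2 - \<epsilon>\<^sup>2"] by (meson not_le)
  define b where "b k = (if k \<in> F then a k else 0)" for k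
  have b_sum: "((\<lambda>k. (cmod (b k))\<^sup>2) has_sum (\<Sum>k\<in>F. (cmod (a k))\<^sup>2)) UNIV"
    using has_sum_finite[OF F(1), of "\<lambda>k. (cmod (a k))\<^sup>2"]
    by (subst has_sum_cong_neutral[where T = F and g = "\<lambda>k. (cmod (a k))\<^sup>2"]) (auto simp: b_def)
  then have b: "square_summable b"
    by (auto simp: square_summable_def summable_on_def)
  have ab: "square_summable (\<lambda>k. a k - b k)"
    by (rule square_summable_diff[OF a(2) b])
  have "((\<lambda>k. (cmod (a k))\<^sup>2 - (cmod (b k))\<^sup>2) has_sum ((l2_norm a)\<^sup>2 - (\<Sum>k\<in>F. (cmod (a k))\<^sup>2))) UNIV"
    using has_sum_add[OF l2_norm_has_sum[OF a(2)] has_sum_cmult_right[OF b_sum, of "-1"]] by simp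
  moreover have "(cmod (a k))\<^sup>2 - (cmod (b k))\<^sup>2 = (cmod (a k - b k))\<^sup>2" for k
    by (simp add: b_def)
  ultimately have "(l2_norm (\<lambda>k. a k - b k))\<^sup>2 = (l2_norm a)\<^sup>2 - (\<Sum>k\<in>F. (cmod (a k))\<^sup>2)"
    using has_sum_unique[OF l2_norm_has_sum[OF ab]] by simp
  then have "(l2_norm (\<lambda>k. a k - b k))\<^sup>2 \<le> \<epsilon>\<^sup>2"
    using F(2) by simp
  then have small: "l2_norm (\<lambda>k. a k - b k) \<le> \<epsilon>"
    by (rule power2_le_imp_le) (use \<epsilon> in simp)
  have "hartogs_series (\<lambda>p. f p - hartogs_function b p) (\<lambda>k. a k - b k)"
    using hartogs_series_add[OF a(1) hartogs_series_cmult[OF hartogs_function_series[OF b], of "-1"]] by simp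
  then have "hartogs_norm (\<lambda>p. f p - hartogs_function b p) \<le> \<epsilon>"
    using hartogs_norm_eq_l2_norm[OF _ ab] small by simp
  with hartogs_function_in_H2[OF b] hartogs_function_finite_bounded[OF F(1), of _ a, folded b_def[abs_def]]
  show ?thesis by blast
qed

text \<open>Both \<open>f \<mapsto> q f\<close> and the norm are continuous on the Hardy space, so the identity extends from the
  dense set of functions with \<open>w f\<close> bounded. Continuity of \<open>f \<mapsto> q f\<close> follows from any bound of
  \<open>q\<close>.\<close>

theorem hartogs_inner_function_isometry:
  assumes q: "hartogs_inner_function q" and f: "f \<in> hartogs_H2"
  shows "(\<lambda>p. q p * f p) \<in> hartogs_H2" and "hartogs_norm (\<lambda>p. q p * f p) = hartogs_norm f"
proof -
  obtain C where C: "\<And>p. p \<in> hartogs_triangle \<Longrightarrow> cmod (q p) \<le> C"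
    using q unfolding hartogs_inner_function_def bounded_iff by blast
  have hq: "holomorphic2_on q hartogs_triangle"
    using q by (simp add: hartogs_inner_function_def)
  note mult = hartogs_H2_bounded_mult[OF hq C]
  show qf: "(\<lambda>p. q p * f p) \<in> hartogs_H2"
    by (rule mult(1)[OF _ f])
  have C0: "0 \<le> C"
    using order_trans[OF norm_ge_zero C[OF hartogs_torus_mem[of "1/2" "1/2" 0 0]]] by simp
  have "\<bar>hartogs_norm (\<lambda>p. q p * f p) - hartogs_norm f\<bar> \<le> 0 + e" if e: "e > 0" for e
  proof -
    \<comment> \<open>Replacing \<open>f\<close> by \<open>g\<close> costs \<open>\<epsilon>\<close> in the norm of \<open>f\<close> and \<open>C \<epsilon>\<close> in the norm of \<open>q f\<close>.\<close>
    define \<epsilon> where "\<epsilon> = e / (C + 1)"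
    have \<epsilon>: "0 < \<epsilon>" using e C0 by (simp add: \<epsilon>_def)
    obtain g B where g: "g \<in> hartogs_H2" "\<And>p. p \<in> hartogs_triangle \<Longrightarrow> cmod (snd p * g p) \<le> B"
        "hartogs_norm (\<lambda>p. f p - g p) \<le> \<epsilon>"
      using hartogs_H2_approx_bounded[OF f \<epsilon>] by blast
    have fg: "(\<lambda>p. f p - g p) \<in> hartogs_H2" and qg: "(\<lambda>p. q p * g p) \<in> hartogs_H2"
      using hartogs_H2_diff[OF f g(1)] mult(1)[OF _ g(1)] by simp_all
    have iso: "hartogs_norm (\<lambda>p. q p * g p) = hartogs_norm g"
      by (rule hartogs_inner_function_norm_bounded[OF q g(1,2)])
    have d: "hartogs_norm (\<lambda>p. q p * (f p - g p)) \<le> C * \<epsilon>"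
      using order_trans[OF mult(2)[OF _ fg] mult_left_mono[OF g(3) C0]] by simp
    have dist: "\<bar>hartogs_norm u - hartogs_norm v\<bar> \<le> hartogs_norm (\<lambda>p. u p - v p)"
      if u: "u \<in> hartogs_H2" and v: "v \<in> hartogs_H2" for u v
      using hartogs_norm_triangle[OF hartogs_H2_diff[OF u v] v] hartogs_norm_triangle[OF hartogs_H2_diff[OF v u] u]
        hartogs_norm_minus_commute[of u v] by simp
    have "\<bar>hartogs_norm f - hartogs_norm g\<bar> \<le> \<epsilon>"
      using dist[OF f g(1)] g(3) by simp
    moreover have "\<bar>hartogs_norm (\<lambda>p. q p * f p) - hartogs_norm (\<lambda>p. q p * g p)\<bar> \<le> C * \<epsilon>"
      using dist[OF qf qg] d by (simp add: right_diff_distrib)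
    ultimately have "\<bar>hartogs_norm (\<lambda>p. q p * f p) - hartogs_norm f\<bar> \<le> C * \<epsilon> + \<epsilon>"
      unfolding iso by linarith
    also have "\<dots> = (C + 1) * \<epsilon>" by (simp add: algebra_simps)
    also have "\<dots> = e" using C0 by (simp add: \<epsilon>_def)
    finally show ?thesis by simp
  qed
  then have "\<bar>hartogs_norm (\<lambda>p. q p * f p) - hartogs_norm f\<bar> \<le> 0"
    by (rule field_le_epsilon)
  then show "hartogs_norm (\<lambda>p. q p * f p) = hartogs_norm f" by simp
qed

text \<open>The inner product is built from norms of combinations \<open>f + c g\<close>, all of which \<open>q\<close> preserves.\<close>

lemma hartogs_inner_mult_inner_function:
  assumes q: "hartogs_inner_function q" and f: "f \<in> hartogs_H2" and g: "g \<in> hartogs_H2"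
  shows "hartogs_inner (\<lambda>p. q p * f p) (\<lambda>p. q p * g p) = hartogs_inner f g"
proof -
  have "hartogs_norm (\<lambda>p. q p * f p + \<i> ^ k * (q p * g p)) = hartogs_norm (\<lambda>p. f p + \<i> ^ k * g p)" for k
    using hartogs_inner_function_isometry(2)[OF q hartogs_H2_add[OF f hartogs_H2_cmult[OF g]], of "\<i> ^ k"]
    by (simp add: algebra_simps)
  then show ?thesis
    by (simp add: hartogs_inner_def)
qed

section \<open>The submodule of an inner function\<close>

lemma M_z_in_hartogs_H2:
  assumes "f \<in> hartogs_H2"
  shows "M_z f \<in> hartogs_H2"
  unfolding M_z_def
proof (rule hartogs_H2_bounded_mult(1)[OF _ _ assms, where C = 1])
  show "holomorphic2_on fst hartogs_triangle"
    unfolding holomorphic2_on_def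
    by (intro ballI exI[of _ 1] exI[of _ 0]) (auto intro!: derivative_eq_intros)
qed (auto simp: hartogs_triangle_def)

lemma M_w_in_hartogs_H2:
  assumes "f \<in> hartogs_H2"
  shows "M_w f \<in> hartogs_H2"
  unfolding M_w_def
proof (rule hartogs_H2_bounded_mult(1)[OF _ _ assms, where C = 1])
  show "holomorphic2_on snd hartogs_triangle"
    unfolding holomorphic2_on_def
    by (intro ballI exI[of _ 0] exI[of _ 1]) (auto intro!: derivative_eq_intros)
qed (auto simp: hartogs_triangle_def)

text \<open>By the isometry the factors \<open>g n\<close> in \<open>F n = q g n\<close> form a Cauchy sequence, so they converge to
  some \<open>h\<close>, and \<open>q h\<close> is the limit of \<open>F n\<close>.\<close>

lemma mult_H2_closed:
  assumes q: "hartogs_inner_function q"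
    and F: "\<And>n::nat. F n \<in> mult_H2 q" and f: "f \<in> hartogs_H2"
    and lim: "(\<lambda>n. hartogs_norm (\<lambda>p. F n p - f p)) \<longlonglongrightarrow> 0"
  shows "f \<in> mult_H2 q"
proof -
  note iso = hartogs_inner_function_isometry[OF q]
  have "\<exists>g. g \<in> hartogs_H2 \<and> F n = (\<lambda>p. q p * g p)" for n
    using F[of n] by (auto simp: mult_H2_def)
  then obtain g where g: "\<And>n. g n \<in> hartogs_H2" and Fg: "\<And>n. F n = (\<lambda>p. q p * g n p)"
    by metis
  have "\<exists>a. hartogs_series (g n) a \<and> square_summable a" for n
    using hartogs_H2E[OF g] by metis
  then obtain a where a: "\<And>n. hartogs_series (g n) (a n)" "\<And>n. square_summable (a n)"
    by metis
  have FH: "F n \<in> hartogs_H2" for n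
    unfolding Fg by (rule iso(1)[OF g])
  have diff_series: "hartogs_series (\<lambda>p. u p - v p) (\<lambda>k. b k - c k)"
    if "hartogs_series u b" "hartogs_series v c" for u v b c
    using hartogs_series_add[OF that(1) hartogs_series_cmult[OF that(2), of "-1"]] by simp
  have dist: "l2_norm (\<lambda>k. a m k - a n k) \<le> hartogs_norm (\<lambda>p. F m p - f p) + hartogs_norm (\<lambda>p. F n p - f p)" for m n
  proof -
    have "l2_norm (\<lambda>k. a m k - a n k) = hartogs_norm (\<lambda>p. g m p - g n p)"
      by (rule hartogs_norm_eq_l2_norm[symmetric]) (intro diff_series a square_summable_diff)+
    also have "\<dots> = hartogs_norm (\<lambda>p. F m p - F n p)"
      using iso(2)[OF hartogs_H2_diff[OF g g]] by (simp add: Fg right_diff_distrib)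
    also have "\<dots> \<le> hartogs_norm (\<lambda>p. F m p - f p) + hartogs_norm (\<lambda>p. f p - F n p)"
      using hartogs_norm_triangle[OF hartogs_H2_diff[OF FH f] hartogs_H2_diff[OF f FH]] by simp
    finally show ?thesis
      by (simp add: hartogs_norm_minus_commute[of f])
  qed
  have cauchy: "\<exists>N. \<forall>m\<ge>N. \<forall>n\<ge>N. l2_norm (\<lambda>k. a m k - a n k) \<le> \<epsilon>" if \<epsilon>: "0 < \<epsilon>" for \<epsilon>
  proof -
    obtain N where N: "\<And>n. n \<ge> N \<Longrightarrow> hartogs_norm (\<lambda>p. F n p - f p) < \<epsilon> / 2"
      using order_tendstoD(2)[OF lim, of "\<epsilon> / 2"] \<epsilon> by (auto simp: eventually_sequentially)
    have "l2_norm (\<lambda>k. a m k - a n k) \<le> \<epsilon>" if "m \<ge> N" "n \<ge> N" for m n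
      using dist[of m n] N[OF that(1)] N[OF that(2)] by simp
    then show ?thesis by blast
  qed
  obtain b where b: "square_summable b" "(\<lambda>n. l2_norm (\<lambda>k. a n k - b k)) \<longlonglongrightarrow> 0"
    using l2_complete[OF a(2) cauchy] by blast
  define h where "h = hartogs_function b"
  have h: "h \<in> hartogs_H2" "hartogs_series h b"
    unfolding h_def using hartogs_function_in_H2 hartogs_function_series b(1) by blast+
  have qh: "(\<lambda>p. q p * h p) \<in> hartogs_H2"
    by (rule iso(1)[OF h(1)])
  have le: "hartogs_norm (\<lambda>p. f p - q p * h p)
      \<le> hartogs_norm (\<lambda>p. F n p - f p) + l2_norm (\<lambda>k. a n k - b k)" for n
  proof -
    have "hartogs_norm (\<lambda>p. f p - q p * h p)
        \<le> hartogs_norm (\<lambda>p. f p - F n p) + hartogs_norm (\<lambda>p. F n p - q p * h p)"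
      using hartogs_norm_triangle[OF hartogs_H2_diff[OF f FH[of n]] hartogs_H2_diff[OF FH[of n] qh]] by simp
    also have "hartogs_norm (\<lambda>p. F n p - q p * h p) = hartogs_norm (\<lambda>p. g n p - h p)"
      using iso(2)[OF hartogs_H2_diff[OF g h(1)]] by (simp add: Fg right_diff_distrib)
    also have "\<dots> = l2_norm (\<lambda>k. a n k - b k)"
      by (rule hartogs_norm_eq_l2_norm) (intro diff_series a h square_summable_diff b)+
    finally show ?thesis
      by (simp add: hartogs_norm_minus_commute[of f])
  qed
  have "hartogs_norm (\<lambda>p. f p - q p * h p) \<le> 0"
    by (rule tendsto_lowerbound[OF tendsto_add_zero[OF lim b(2)]]) (simp_all add: le)
  then have "hartogs_norm (\<lambda>p. f p - q p * h p) = 0"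
    using hartogs_norm_nonneg[OF hartogs_H2_diff[OF f qh]] by simp
  then have "(\<lambda>p. f p - q p * h p) = (\<lambda>p. 0)"
    by (rule hartogs_norm_eq_0[OF hartogs_H2_diff[OF f qh]])
  then have "f = (\<lambda>p. q p * h p)"
    by (auto simp: fun_eq_iff)
  then show ?thesis
    using h(1) by (auto simp: mult_H2_def)
qed

lemma hartogs_H2_zero: "(\<lambda>p. 0) \<in> hartogs_H2"
proof -
  have "hartogs_function (\<lambda>k. 0) \<in> hartogs_H2"
    by (rule hartogs_function_in_H2) (simp add: square_summable_def)
  moreover have "hartogs_function (\<lambda>k. 0) = (\<lambda>p. 0)"
    by (simp add: hartogs_function_def fun_eq_iff)
  ultimately show ?thesis by simp
qed

theorem mult_H2_submodule:
  assumes q: "hartogs_inner_function q"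
  shows "hartogs_submodule (mult_H2 q)"
  unfolding hartogs_submodule_def
proof (intro conjI ballI allI impI subsetI)
  show "f \<in> hartogs_H2" if "f \<in> mult_H2 q" for f
    using that hartogs_inner_function_isometry(1)[OF q] by (auto simp: mult_H2_def)
  show "(\<lambda>p. 0) \<in> mult_H2 q"
    unfolding mult_H2_def by (rule image_eqI[OF _ hartogs_H2_zero]) simp
  show "(\<lambda>p. f p + g p) \<in> mult_H2 q" if fg: "f \<in> mult_H2 q" "g \<in> mult_H2 q" for f g
  proof -
    obtain u v where "u \<in> hartogs_H2" "f = (\<lambda>p. q p * u p)" "v \<in> hartogs_H2" "g = (\<lambda>p. q p * v p)"
      using fg by (auto simp: mult_H2_def)
    then show ?thesis
      unfolding mult_H2_def
      by (intro image_eqI[OF _ hartogs_H2_add[of u v]]) (auto simp: algebra_simps)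
  qed
  show "(\<lambda>p. c * f p) \<in> mult_H2 q" if "f \<in> mult_H2 q" for c f
  proof -
    obtain u where "u \<in> hartogs_H2" "f = (\<lambda>p. q p * u p)"
      using \<open>f \<in> mult_H2 q\<close> by (auto simp: mult_H2_def)
    then show ?thesis
      unfolding mult_H2_def
      by (intro image_eqI[OF _ hartogs_H2_cmult[of u c]]) (auto simp: algebra_simps)
  qed
  show "f \<in> mult_H2 q" if "(\<forall>n::nat. F n \<in> mult_H2 q) \<and> f \<in> hartogs_H2
       \<and> (\<lambda>n. hartogs_norm (\<lambda>p. F n p - f p)) \<longlonglongrightarrow> 0" for F f
    using mult_H2_closed[OF q, of F f] that by blast
  show "M_z f \<in> mult_H2 q" if "f \<in> mult_H2 q" for f
  proof -
    obtain u where "u \<in> hartogs_H2" "f = (\<lambda>p. q p * u p)"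
      using \<open>f \<in> mult_H2 q\<close> by (auto simp: mult_H2_def)
    then show ?thesis
      unfolding mult_H2_def
      by (intro image_eqI[OF _ M_z_in_hartogs_H2[of u]]) (auto simp: M_z_def algebra_simps)
  qed
  show "M_w f \<in> mult_H2 q" if "f \<in> mult_H2 q" for f
  proof -
    obtain u where "u \<in> hartogs_H2" "f = (\<lambda>p. q p * u p)"
      using \<open>f \<in> mult_H2 q\<close> by (auto simp: mult_H2_def)
    then show ?thesis
      unfolding mult_H2_def
      by (intro image_eqI[OF _ M_w_in_hartogs_H2[of u]]) (auto simp: M_w_def algebra_simps)
  qed
qed

section \<open>Adjoints and the failure of double commutation\<close>

text \<open>An element of \<open>S\<close> that represents the functional \<open>f \<mapsto> \<langle>T f, g\<rangle>\<close> is the value of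
  the adjoint: the difference \<open>d\<close> of two
  representing elements lies in \<open>S\<close> and is orthogonal to itself.\<close>

lemma adjoint_on_eqI:
  assumes S: "S \<subseteq> hartogs_H2" "\<And>f g. f \<in> S \<Longrightarrow> g \<in> S \<Longrightarrow> (\<lambda>p. f p - g p) \<in> S"
    and h: "h \<in> S" "\<And>f. f \<in> S \<Longrightarrow> hartogs_inner (T f) g = hartogs_inner f h"
  shows "adjoint_on S T g = h"
  unfolding adjoint_on_def
proof (rule the_equality)
  show "h \<in> S \<and> (\<forall>f\<in>S. hartogs_inner (T f) g = hartogs_inner f h)"
    using h by blast
  fix h' assume h': "h' \<in> S \<and> (\<forall>f\<in>S. hartogs_inner (T f) g = hartogs_inner f h')"
  obtain a where a: "hartogs_series h a" "square_summable a"
    using hartogs_H2E h(1) S(1) by blast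
  obtain a' where a': "hartogs_series h' a'" "square_summable a'"
    using hartogs_H2E h' S(1) by blast
  define d where "d = (\<lambda>p. h p - h' p)"
  define c where "c k = a k - a' k" for k
  have dS: "d \<in> S"
    unfolding d_def using S(2) h(1) h' by blast
  have d: "hartogs_series d c" "square_summable c"
    using hartogs_series_add[OF a(1) hartogs_series_cmult[OF a'(1), of "-1"]] square_summable_diff[OF a(2) a'(2)]
    by (simp_all add: d_def c_def[abs_def])
  have "hartogs_inner d h = hartogs_inner d h'"
    using dS h(2) h' by metis
  moreover have "((\<lambda>k. c k * cnj (a k) + (-1) * (c k * cnj (a' k))) has_sum
      (hartogs_inner d h + (-1) * hartogs_inner d h')) UNIV"
    by (intro has_sum_add has_sum_cmult_right hartogs_inner_has_sum d a a')
  moreover have "c k * cnj (a k) + (-1) * (c k * cnj (a' k)) = of_real ((cmod (c k))\<^sup>2)" for k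
    unfolding complex_norm_square by (simp add: c_def algebra_simps)
  moreover have "((\<lambda>k. complex_of_real ((cmod (c k))\<^sup>2)) has_sum of_real ((l2_norm c)\<^sup>2)) UNIV"
    by (rule has_sum_of_real[OF l2_norm_has_sum[OF d(2)]])
  ultimately have "((\<lambda>k. complex_of_real ((cmod (c k))\<^sup>2)) has_sum 0) UNIV"
    "((\<lambda>k. complex_of_real ((cmod (c k))\<^sup>2)) has_sum of_real ((l2_norm c)\<^sup>2)) UNIV"
    by simp_all
  then have "complex_of_real ((l2_norm c)\<^sup>2) = 0"
    using has_sum_unique by blast
  then have "hartogs_norm d = 0"
    using hartogs_norm_eq_l2_norm[OF d] by simp
  then have "d = (\<lambda>p. 0)"
    using hartogs_norm_eq_0 dS S(1) by blast
  then show "h' = h"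
    by (auto simp: d_def fun_eq_iff)
qed

definition hartogs_monomial :: "nat \<Rightarrow> nat \<Rightarrow> complex \<times> complex \<Rightarrow> complex"
  where "hartogs_monomial i j p =
    (if p \<in> hartogs_triangle then (fst p / snd p) ^ i * snd p ^ j / snd p else 0)"

lemma hartogs_monomial_series:
  "hartogs_series (hartogs_monomial i j) (\<lambda>k. if k = (i, j) then 1 else 0)"
  unfolding hartogs_series_def
proof (intro allI impI)
  fix \<zeta> w :: complex assume *: "cmod \<zeta> < 1" "0 < cmod w" "cmod w < 1"
  have "((\<lambda>k. \<zeta> ^ fst k * w ^ snd k) has_sum (\<Sum>k\<in>{(i, j)}. \<zeta> ^ fst k * w ^ snd k)) {(i, j)}"
    by (rule has_sum_finite) simp
  then have "((\<lambda>k. (if k = (i, j) then 1 else 0) * \<zeta> ^ fst k * w ^ snd k) has_sum (\<zeta> ^ i * w ^ j)) UNIV"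
    by (subst has_sum_cong_neutral[where T = "{(i, j)}" and g = "\<lambda>k. \<zeta> ^ fst k * w ^ snd k"]) auto
  moreover have "w * hartogs_monomial i j (\<zeta> * w, w) = \<zeta> ^ i * w ^ j"
    using hartogs_triangle_polar[OF *] * by (simp add: hartogs_monomial_def)
  ultimately show "((\<lambda>k. (if k = (i, j) then 1 else 0) * \<zeta> ^ fst k * w ^ snd k) has_sum
      (w * hartogs_monomial i j (\<zeta> * w, w))) UNIV"
    by simp
qed

lemma square_summable_delta: "square_summable (\<lambda>k. if k = l then 1 else 0)"
  unfolding square_summable_def
  by (subst summable_on_cong_neutral[where T = "{l}" and g = "\<lambda>k. 1"]) auto

lemma hartogs_monomial_in_H2: "hartogs_monomial i j \<in> hartogs_H2"
  using hartogs_monomial_series[of i j] square_summable_delta[of "(i, j)"]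
  unfolding hartogs_H2_iff_series by (auto simp: hartogs_monomial_def)

lemma hartogs_inner_monomial:
  assumes "hartogs_series f a" "square_summable a"
  shows "hartogs_inner f (hartogs_monomial i j) = a (i, j)"
proof -
  have "((\<lambda>k. a k * cnj (if k = (i, j) then 1 else 0)) has_sum hartogs_inner f (hartogs_monomial i j)) UNIV"
    by (rule hartogs_inner_has_sum[OF assms hartogs_monomial_series square_summable_delta])
  moreover have "((\<lambda>k. a k * cnj (if k = (i, j) then 1 else 0)) has_sum (\<Sum>k\<in>{(i, j)}. a k)) UNIV"
    by (subst has_sum_cong_neutral[where T = "{(i, j)}" and g = a]) (auto intro: has_sum_finiteI)
  ultimately show ?thesis
    using has_sum_unique by fastforce
qed

text \<open>Since \<open>z = \<zeta> w\<close>, multiplication by \<open>z\<close> shifts the coefficients in both directions at once.\<close>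

lemma M_z_series:
  assumes "hartogs_series f a"
  shows "hartogs_series (M_z f) (\<lambda>k. if fst k = 0 \<or> snd k = 0 then 0 else a (fst k - 1, snd k - 1))"
    (is "hartogs_series _ ?b")
  unfolding hartogs_series_def
proof (intro allI impI)
  fix \<zeta> w :: complex assume *: "cmod \<zeta> < 1" "0 < cmod w" "cmod w < 1"
  let ?\<sigma> = "\<lambda>k :: nat \<times> nat. (Suc (fst k), Suc (snd k))"
  let ?g = "\<lambda>k. ?b k * \<zeta> ^ fst k * w ^ snd k"
  have "((\<lambda>k. \<zeta> * w * (a k * \<zeta> ^ fst k * w ^ snd k)) has_sum (\<zeta> * w * (w * f (\<zeta> * w, w)))) UNIV"
    using assms * unfolding hartogs_series_def by (intro has_sum_cmult_right) blast
  then have "((?g \<circ> ?\<sigma>) has_sum (w * M_z f (\<zeta> * w, w))) UNIV"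
    by (simp add: o_def M_z_def mult_ac)
  then have "(?g has_sum (w * M_z f (\<zeta> * w, w))) (?\<sigma> ` UNIV)"
    by (subst has_sum_reindex) (auto simp: inj_on_def prod_eq_iff)
  moreover have "?g k = 0" if "k \<notin> ?\<sigma> ` UNIV" for k
  proof -
    have "fst k = 0 \<or> snd k = 0"
    proof (rule ccontr)
      assume "\<not> (fst k = 0 \<or> snd k = 0)"
      then have "k = ?\<sigma> (fst k - 1, snd k - 1)" by (simp add: prod_eq_iff)
      then show False using that by blast
    qed
    then show ?thesis by auto
  qed
  ultimately show "(?g has_sum (w * M_z f (\<zeta> * w, w))) UNIV"
    by (subst has_sum_cong_neutral[where T = "?\<sigma> ` UNIV" and g = ?g]) auto
qed

text \<open>The adjoint of \<open>M_z\<close> on the basis: it lowers both indices and kills the monomials with \<open>j = 0\<close>.\<close>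

lemma hartogs_inner_M_z_monomial:
  assumes f: "f \<in> hartogs_H2"
  shows "hartogs_inner (M_z f) (hartogs_monomial (Suc i) (Suc j)) = hartogs_inner f (hartogs_monomial i j)"
    and "hartogs_inner (M_z f) (hartogs_monomial i 0) = 0"
proof -
  obtain a where a: "hartogs_series f a" "square_summable a"
    using hartogs_H2E[OF f] .
  let ?b = "\<lambda>k. if fst k = 0 \<or> snd k = 0 then 0 else a (fst k - 1, snd k - 1)"
  have "bdd_above ((\<lambda>(s, t). hartogs_mean (M_z f) s t) ` ({0<..<1} \<times> {0<..<1}))"
    using M_z_in_hartogs_H2[OF f] by (simp add: hartogs_H2_def)
  then obtain M where "\<And>r. 0 < r \<Longrightarrow> r < 1 \<Longrightarrow> hartogs_mean (M_z f) r r \<le> M"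
    unfolding bdd_above_def by fastforce
  then have b: "square_summable ?b"
    by (rule hartogs_series_square_summable[OF M_z_series[OF a(1)]])
  show "hartogs_inner (M_z f) (hartogs_monomial (Suc i) (Suc j)) = hartogs_inner f (hartogs_monomial i j)"
    "hartogs_inner (M_z f) (hartogs_monomial i 0) = 0"
    using hartogs_inner_monomial[OF M_z_series[OF a(1)] b] hartogs_inner_monomial[OF a] by simp_all
qed

text \<open>The two orders of \<open>M_w\<close> and the adjoint of \<open>M_z\<close> are compared on \<open>q e 1 0\<close>: one gives \<open>q e 0 0\<close>,
  of norm 1, and the other gives 0.\<close>

theorem proposition2p1:
  fixes q :: "complex \<times> complex \<Rightarrow> complex"
  assumes "hartogs_inner_function q"
  shows "hartogs_submodule (mult_H2 q) \<and> \<not> doubly_commuting (mult_H2 q)"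
proof
  note q = assms
  let ?S = "mult_H2 q"
  let ?e = "\<lambda>i j p. q p * hartogs_monomial i j p"
  show sub: "hartogs_submodule ?S"
    by (rule mult_H2_submodule[OF q])
  have S: "?S \<subseteq> hartogs_H2" "(\<lambda>p. 0) \<in> ?S"
    using sub unfolding hartogs_submodule_def by simp_all
  have S_diff: "(\<lambda>p. f p - g p) \<in> ?S" if fg: "f \<in> ?S" "g \<in> ?S" for f g
  proof -
    obtain u v where "u \<in> hartogs_H2" "f = (\<lambda>p. q p * u p)" "v \<in> hartogs_H2" "g = (\<lambda>p. q p * v p)"
      using fg by (auto simp: mult_H2_def)
    then show ?thesis
      unfolding mult_H2_def
      by (intro image_eqI[OF _ hartogs_H2_diff[of u v]]) (auto simp: algebra_simps)
  qed
  have eS: "?e i j \<in> ?S" for i j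
    unfolding mult_H2_def by (rule imageI[OF hartogs_monomial_in_H2])
  have inner_shift: "hartogs_inner (M_z (\<lambda>p. q p * g p)) (?e i j) = hartogs_inner (M_z g) (hartogs_monomial i j)"
    if g: "g \<in> hartogs_H2" for g i j
    using hartogs_inner_mult_inner_function[OF q M_z_in_hartogs_H2[OF g] hartogs_monomial_in_H2]
    by (simp add: M_z_def mult.left_commute)
  have adj1: "adjoint_on ?S M_z (?e 1 1) = ?e 0 0"
  proof (rule adjoint_on_eqI[OF S(1) S_diff eS])
    fix f assume "f \<in> ?S"
    then obtain g where g: "g \<in> hartogs_H2" "f = (\<lambda>p. q p * g p)"
      by (auto simp: mult_H2_def)
    show "hartogs_inner (M_z f) (?e 1 1) = hartogs_inner f (?e 0 0)"
      using inner_shift[OF g(1)] hartogs_inner_M_z_monomial(1)[OF g(1), of 0 0]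
        hartogs_inner_mult_inner_function[OF q g(1) hartogs_monomial_in_H2] g(2) by simp
  qed
  have zero: "hartogs_inner f (\<lambda>p. 0) = 0" if f: "f \<in> hartogs_H2" for f
  proof -
    obtain a where a: "hartogs_series f a" "square_summable a"
      using hartogs_H2E[OF f] .
    have "hartogs_series (\<lambda>p. 0) (\<lambda>k. 0)" "square_summable (\<lambda>k::nat\<times>nat. 0)"
      by (simp_all add: hartogs_series_def square_summable_def)
    from hartogs_inner_has_sum[OF a this] show ?thesis
      using has_sum_unique[OF has_sum_0_simp] by fastforce
  qed
  have adj2: "adjoint_on ?S M_z (?e 1 0) = (\<lambda>p. 0)"
  proof (rule adjoint_on_eqI[OF S(1) S_diff S(2)])
    fix f assume f: "f \<in> ?S"
    then obtain g where g: "g \<in> hartogs_H2" "f = (\<lambda>p. q p * g p)"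
      by (auto simp: mult_H2_def)
    show "hartogs_inner (M_z f) (?e 1 0) = hartogs_inner f (\<lambda>p. 0)"
      using inner_shift[OF g(1)] hartogs_inner_M_z_monomial(2)[OF g(1)] zero f S(1) g(2) by auto
  qed
  have Mw: "M_w (?e 1 0) = ?e 1 1"
    by (auto simp: M_w_def hartogs_monomial_def fun_eq_iff)
  show "\<not> doubly_commuting ?S"
  proof
    assume "doubly_commuting ?S"
    then have "adjoint_on ?S M_z (M_w (?e 1 0)) = M_w (adjoint_on ?S M_z (?e 1 0))"
      unfolding doubly_commuting_def using eS by blast
    then have e0: "?e 0 0 = (\<lambda>p. 0)"
      unfolding Mw adj1 adj2 by (simp add: M_w_def)
    have "hartogs_inner (?e 0 0) (?e 0 0) = hartogs_inner (hartogs_monomial 0 0) (hartogs_monomial 0 0)"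
      by (intro hartogs_inner_mult_inner_function q hartogs_monomial_in_H2)
    also have "\<dots> = 1"
      using hartogs_inner_monomial[OF hartogs_monomial_series square_summable_delta] by simp
    finally show False
      using zero[OF hartogs_H2_zero] unfolding e0 by simp
  qed
qed

end
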